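(* For every $p\in[2,\infty)$, with $p'=p/(p-1)$, there exist constants $A_p,C_p\in(0,\infty)$ depending only on $p$ such that the following holds for every $A\ge A_p$. Let $\sigma$ be a non-negative locally finite Borel measure on $\mathbb{R}^n$, and let $\mu\colon\mathbb{R}^{n+1}_+\to[0,\infty)$ be a $\sigma\times\eta$-measurable function with $\|1_{\widehat Q}\,\mu\|_{L^{p'}(\sigma;\ell^2)}<\infty$ for every $Q\in\mathscr{D}$. Let $Q_0\in\mathscr{D}$ and let $f\colon\mathbb{R}^{n+1}_+\to[0,\infty)$ be a $\sigma\times\eta$-measurable function such that $$\iint_{\widehat{Q_0}}f\mu\,\mathrm{d}\eta\,\mathrm{d}\sigma<\infty .$$ Let $\mathscr{F}$ be the collection of stopping cubes for $f$ with top cube $Q_0$ and parameter $A$ (defined in the context). Then $$\sum_{F\in\mathscr{F}}[f]_F^{\,p}\,\|\varphi_F\|_{L^p(\sigma;\ell^2)}^p\le C_p\,\|f\|_{L^p(\sigma;\ell^2)}^p .$$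
   Context: Fix a dimension $n\ge1$. Let $\eta:=\sum_{k\in\mathbb{Z}}\delta_{2^k}$, a measure on $(0,\infty)$ ($\delta_a$ is the Dirac mass at $a$), and equip $\mathbb{R}^{n+1}_+:=\mathbb{R}^n\times(0,\infty)$ with the product measure $\sigma\times\eta$. A $\sigma\times\eta$-measurable function $f$ on $\mathbb{R}^{n+1}_+$ is identified with the sequence $\{f_k\}_{k\in\mathbb{Z}}$ of Borel functions on $\mathbb{R}^n$ given by $f_k(x):=f(x,2^{-k})$ (only the values at $t\in\{2^k:k\in\mathbb{Z}\}$ matter). Write $$|f|_{\ell^2}(x):=\Big(\sum_{k\in\mathbb{Z}}|f_k(x)|^2\Big)^{1/2},\qquad \|f\|_{L^q(\sigma;\ell^2)}:=\Big(\int_{\mathbb{R}^n}|f|_{\ell^2}(x)^q\,\mathrm{d}\sigma(x)\Big)^{1/q}\in[0,\infty].$$ $\mathscr{D}:=\{2^{-k}([0,1)^n+m):k\in\mathbb{Z},\,m\in\mathbb{Z}^n\}$ is the dyadic lattice; for $Q\in\mathscr{D}$ with side length $\ell(Q)$, the Carleson box is $\widehat Q:=Q\times(0,\ell(Q)]$. $1_A$ is the characteristic function of a set $A$. Test functions: for $Q\in\mathscr{D}$, $\varphi_Q:=|1_{\widehat Q}\,\mu|_{\ell^2}^{p'-2}\,1_{\widehat Q}\,\mu$, i.e. $\varphi_Q(x,t)=|1_{\widehat Q}\mu|_{\ell^2}(x)^{p'-2}\,1_{\widehat Q}(x,t)\mu(x,t)$, understood to be $0$ when $|1_{\widehat Q}\mu|_{\ell^2}(x)\in\{0,\infty\}$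 (the value $\infty$ occurs only on a $\sigma$-null set). Average-type quantity: for $Q\in\mathscr{D}$, $$[f]_Q:=\frac{\iint_{\widehat Q}f\mu\,\mathrm{d}\eta\,\mathrm{d}\sigma}{\iint_{\widehat Q}\varphi_Q\mu\,\mathrm{d}\eta\,\mathrm{d}\sigma}.$$ Stopping cubes for $f$ with top cube $Q_0$ and parameter $A>0$: set $\mathscr{F}_0:=\{Q_0\}$. Given $\mathscr{F}_k$ and $F\in\mathscr{F}_k$, let $\mathrm{ch}_{\mathscr{F}}(F)$ be the set of maximal (with respect to inclusion) cubes $Q\in\mathscr{D}$ such that $Q\subset F$ and $$\frac{\iint_{\widehat Q}f\mu\,\mathrm{d}\eta\,\mathrm{d}\sigma}{\iint_{\widehat Q}\varphi_F\mu\,\mathrm{d}\eta\,\mathrm{d}\sigma}>A\,\frac{\iint_{\widehat F}f\mu\,\mathrm{d}\eta\,\mathrm{d}\sigma}{\iint_{\widehat F}\varphi_F\mu\,\mathrm{d}\eta\,\mathrm{d}\sigma}.$$ Set $\mathscr{F}_{k+1}:=\bigcup_{F\in\mathscr{F}_k}\mathrm{ch}_{\mathscr{F}}(F)$ and $\mathscr{F}:=\bigcup_{k=0}^\infty\mathscr{F}_k$ (as a set of cubes, each counted once). Convention: $0/0:=0$ in all these quotients (whenever a denominator above vanishes, so does the corresponding numerator). *)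

theory Defs
  imports "HOL-Analysis.Analysis"
begin

text \<open>Since the constants in the statement must not depend on the dimension, the dimension is a
  natural number \<open>n\<close> and not a type: points of \<open>n\<close>-space are the extensional functions in
  \<open>{..<n} \<rightarrow>\<^sub>E UNIV\<close>, with the product topology. The product sigma-algebra used below is the Borel
  sigma-algebra of that topology, see \<open>sets_Rn_eq_borel\<close>.\<close>

abbreviation Rn_points :: "nat \<Rightarrow> (nat \<Rightarrow> real) set" where
  "Rn_points n \<equiv> {..<n} \<rightarrow>\<^sub>E UNIV"

abbreviation Rn_topology :: "nat \<Rightarrow> (nat \<Rightarrow> real) topology" where
  "Rn_topology n \<equiv> product_topology (\<lambda>_. euclideanreal) {..<n}"

abbreviation Rn_borel :: "nat \<Rightarrow> (nat \<Rightarrow> real) measure" where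
  "Rn_borel n \<equiv> Pi\<^sub>M {..<n} (\<lambda>_. borel)"

definition locally_finite_borel_measure :: "nat \<Rightarrow> (nat \<Rightarrow> real) measure \<Rightarrow> bool" where
  "locally_finite_borel_measure n \<sigma> \<longleftrightarrow>
     sets \<sigma> = sets (Rn_borel n) \<and>
     (\<forall>x\<in>Rn_points n. \<exists>U. openin (Rn_topology n) U \<and> x \<in> U \<and> emeasure \<sigma> U < \<infinity>)"

text \<open>The sum of the Dirac masses at \<open>2 powi k\<close>, as image of the counting measure on the integers;
  see \<open>emeasure_eta\<close>.\<close>

definition eta :: "real measure" where
  "eta = distr (count_space (UNIV :: int set)) (restrict_space borel {0<..}) (\<lambda>k. 2 powi k)"

definition dyadic_cube :: "nat \<Rightarrow> int \<Rightarrow> (nat \<Rightarrow> int) \<Rightarrow> (nat \<Rightarrow> real) set" where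
  "dyadic_cube n k m =
     {x \<in> Rn_points n. \<forall>i<n. 2 powi (- k) * real_of_int (m i) \<le> x i \<and>
                               x i < 2 powi (- k) * (real_of_int (m i) + 1)}"

definition dyadic_lattice :: "nat \<Rightarrow> (nat \<Rightarrow> real) set set" where
  "dyadic_lattice n = {dyadic_cube n k m | k m. True}"

text \<open>Well defined on the dyadic lattice for \<open>n \<ge> 1\<close>, see \<open>side_length_dyadic_cube\<close>.\<close>

definition side_length :: "nat \<Rightarrow> (nat \<Rightarrow> real) set \<Rightarrow> real" where
  "side_length n Q = (THE l. \<exists>k m. Q = dyadic_cube n k m \<and> l = 2 powi (- k))"

definition carleson_box :: "nat \<Rightarrow> (nat \<Rightarrow> real) set \<Rightarrow> ((nat \<Rightarrow> real) \<times> real) set" where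
  "carleson_box n Q = Q \<times> {0<..side_length n Q}"

text \<open>Powers of extended nonnegative numbers, only used with exponents \<open>a > 0\<close>.\<close>

definition ennpowr :: "ennreal \<Rightarrow> real \<Rightarrow> ennreal" where
  "ennpowr x a = (if x = \<infinity> then \<infinity> else ennreal (enn2real x powr a))"

definition l2_norm :: "((nat \<Rightarrow> real) \<times> real \<Rightarrow> real) \<Rightarrow> (nat \<Rightarrow> real) \<Rightarrow> ennreal" where
  "l2_norm f x = ennpowr (\<Sum>\<^sub>\<infinity>k::int. ennreal (\<bar>f (x, 2 powi (- k))\<bar>\<^sup>2)) (1 / 2)"

definition Lq_l2_norm ::
  "real \<Rightarrow> (nat \<Rightarrow> real) measure \<Rightarrow> ((nat \<Rightarrow> real) \<times> real \<Rightarrow> real) \<Rightarrow> ennreal" where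
  "Lq_l2_norm q \<sigma> f = ennpowr (\<integral>\<^sup>+x. ennpowr (l2_norm f x) q \<partial>\<sigma>) (1 / q)"

definition conj_exponent :: "real \<Rightarrow> real" where
  "conj_exponent p = p / (p - 1)"

definition test_fun ::
  "nat \<Rightarrow> real \<Rightarrow> ((nat \<Rightarrow> real) \<times> real \<Rightarrow> real) \<Rightarrow> (nat \<Rightarrow> real) set \<Rightarrow> (nat \<Rightarrow> real) \<times> real \<Rightarrow> real" where
  "test_fun n p \<mu> Q = (\<lambda>(x, t).
     let N = l2_norm (\<lambda>z. indicator (carleson_box n Q) z * \<mu> z) x in
     if N = 0 \<or> N = \<infinity> then 0
     else enn2real N powr (conj_exponent p - 2) * (indicator (carleson_box n Q) (x, t) * \<mu> (x, t)))"

definition box_integral ::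
  "nat \<Rightarrow> (nat \<Rightarrow> real) measure \<Rightarrow> ((nat \<Rightarrow> real) \<times> real \<Rightarrow> real) \<Rightarrow>
     (nat \<Rightarrow> real) set \<Rightarrow> ((nat \<Rightarrow> real) \<times> real \<Rightarrow> real) \<Rightarrow> ennreal" where
  "box_integral n \<sigma> \<mu> Q g = (\<integral>\<^sup>+z\<in>carleson_box n Q. ennreal (g z * \<mu> z) \<partial>(\<sigma> \<Otimes>\<^sub>M eta))"

text \<open>The convention \<open>0 / 0 = 0\<close> is built into the division of \<^typ>\<open>ennreal\<close>.\<close>

definition avg ::
  "nat \<Rightarrow> real \<Rightarrow> (nat \<Rightarrow> real) measure \<Rightarrow> ((nat \<Rightarrow> real) \<times> real \<Rightarrow> real) \<Rightarrow>
     ((nat \<Rightarrow> real) \<times> real \<Rightarrow> real) \<Rightarrow> (nat \<Rightarrow> real) set \<Rightarrow> ennreal" where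
  "avg n p \<sigma> \<mu> f Q = box_integral n \<sigma> \<mu> Q f / box_integral n \<sigma> \<mu> Q (test_fun n p \<mu> Q)"

definition stopping_candidates ::
  "nat \<Rightarrow> real \<Rightarrow> (nat \<Rightarrow> real) measure \<Rightarrow> ((nat \<Rightarrow> real) \<times> real \<Rightarrow> real) \<Rightarrow>
     ((nat \<Rightarrow> real) \<times> real \<Rightarrow> real) \<Rightarrow> real \<Rightarrow> (nat \<Rightarrow> real) set \<Rightarrow> (nat \<Rightarrow> real) set set" where
  "stopping_candidates n p \<sigma> \<mu> f A F =
     {Q \<in> dyadic_lattice n. Q \<subseteq> F \<and>
        box_integral n \<sigma> \<mu> Q f / box_integral n \<sigma> \<mu> Q (test_fun n p \<mu> F)
        > ennreal A * (box_integral n \<sigma> \<mu> F f / box_integral n \<sigma> \<mu> F (test_fun n p \<mu> F))}"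

definition stopping_children ::
  "nat \<Rightarrow> real \<Rightarrow> (nat \<Rightarrow> real) measure \<Rightarrow> ((nat \<Rightarrow> real) \<times> real \<Rightarrow> real) \<Rightarrow>
     ((nat \<Rightarrow> real) \<times> real \<Rightarrow> real) \<Rightarrow> real \<Rightarrow> (nat \<Rightarrow> real) set \<Rightarrow> (nat \<Rightarrow> real) set set" where
  "stopping_children n p \<sigma> \<mu> f A F =
     {Q \<in> stopping_candidates n p \<sigma> \<mu> f A F.
        \<forall>R\<in>stopping_candidates n p \<sigma> \<mu> f A F. Q \<subseteq> R \<longrightarrow> R = Q}"

primrec stopping_generation ::
  "nat \<Rightarrow> real \<Rightarrow> (nat \<Rightarrow> real) measure \<Rightarrow> ((nat \<Rightarrow> real) \<times> real \<Rightarrow> real) \<Rightarrow>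
     ((nat \<Rightarrow> real) \<times> real \<Rightarrow> real) \<Rightarrow> real \<Rightarrow> (nat \<Rightarrow> real) set \<Rightarrow> nat \<Rightarrow> (nat \<Rightarrow> real) set set" where
  "stopping_generation n p \<sigma> \<mu> f A Q\<^sub>0 0 = {Q\<^sub>0}"
| "stopping_generation n p \<sigma> \<mu> f A Q\<^sub>0 (Suc k) =
     (\<Union>F\<in>stopping_generation n p \<sigma> \<mu> f A Q\<^sub>0 k. stopping_children n p \<sigma> \<mu> f A F)"

definition stopping_cubes ::
  "nat \<Rightarrow> real \<Rightarrow> (nat \<Rightarrow> real) measure \<Rightarrow> ((nat \<Rightarrow> real) \<times> real \<Rightarrow> real) \<Rightarrow>
     ((nat \<Rightarrow> real) \<times> real \<Rightarrow> real) \<Rightarrow> real \<Rightarrow> (nat \<Rightarrow> real) set \<Rightarrow> (nat \<Rightarrow> real) set set" where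
  "stopping_cubes n p \<sigma> \<mu> f A Q\<^sub>0 = (\<Union>k. stopping_generation n p \<sigma> \<mu> f A Q\<^sub>0 k)"

lemma openin_Rn_imp_sets:
  assumes "openin (Rn_topology n) U"
  shows "U \<in> sets (Rn_borel n)"
proof -
  define V where "V = {x :: nat \<Rightarrow> real. restrict x {..<n} \<in> U}"
  have "continuous_map (product_topology (\<lambda>_::nat. euclideanreal) UNIV) (Rn_topology n) (\<lambda>x. restrict x {..<n})"
    by (intro continuous_map_componentwise[THEN iffD2])
       (auto intro: continuous_map_product_projection)
  from openin_continuous_map_preimage[OF this assms]
  have "openin (product_topology (\<lambda>_::nat. euclideanreal) UNIV) V"
    by (simp add: V_def)
  hence "open V"
    by (simp add: open_fun_def)
  hence "V \<in> sets (Pi\<^sub>M UNIV (\<lambda>_. borel))"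
    by (simp add: sets_PiM_equal_borel)
  moreover have "(\<lambda>x. x) \<in> Rn_borel n \<rightarrow>\<^sub>M Pi\<^sub>M UNIV (\<lambda>_::nat. borel :: real measure)"
  proof (rule measurable_PiM_single')
    fix i :: nat
    show "(\<lambda>x. x i) \<in> Rn_borel n \<rightarrow>\<^sub>M borel"
    proof (cases "i < n")
      case False
      have "(\<lambda>x. x i) \<in> Rn_borel n \<rightarrow>\<^sub>M borel \<longleftrightarrow>
            (\<lambda>_. undefined :: real) \<in> Rn_borel n \<rightarrow>\<^sub>M borel"
        using False by (intro measurable_cong) (auto simp: space_PiM PiE_def extensional_def)
      thus ?thesis by simp
    qed (auto intro: measurable_component_singleton)
  qed auto
  ultimately have "(\<lambda>x. x) -` V \<inter> space (Rn_borel n) \<in> sets (Rn_borel n)"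
    by (rule measurable_sets[rotated])
  moreover have "(\<lambda>x. x) -` V \<inter> space (Rn_borel n) = U"
    using openin_subset[OF assms]
    by (auto simp: V_def space_PiM PiE_restrict subset_eq)
  ultimately show ?thesis by simp
qed

lemma sets_Rn_eq_borel:
  "sets (Rn_borel n) = sigma_sets (Rn_points n) {U. openin (Rn_topology n) U}"
proof
  have "sets (Rn_borel n) =
      sigma_sets (Rn_points n) {{f \<in> Rn_points n. f i \<in> S} | i S. i \<in> {..<n} \<and> S \<in> sets borel}"
    by (simp add: sets_PiM_single)
  also have "\<dots> \<subseteq> sigma_sets (Rn_points n) {U. openin (Rn_topology n) U}"
  proof (rule sigma_sets_mono, rule subsetI)
    fix E assume "E \<in> {{f \<in> Rn_points n. f i \<in> S} | i S. i \<in> {..<n} \<and> S \<in> sets borel}"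
    then obtain i and S :: "real set"
      where E: "E = {f \<in> Rn_points n. f i \<in> S}" and i: "i \<in> {..<n}" and S: "S \<in> sets borel"
      by blast
    let ?M = "sigma (Rn_points n) {U. openin (Rn_topology n) U}"
    have sub: "{U. openin (Rn_topology n) U} \<subseteq> Pow (Rn_points n)"
      using openin_subset[of "Rn_topology n"] by (auto simp: topspace_product_topology)
    have "(\<lambda>f. f i) \<in> ?M \<rightarrow>\<^sub>M borel"
    proof (rule borel_measurableI)
      fix T :: "real set" assume "open T"
      have "continuous_map (Rn_topology n) euclideanreal (\<lambda>f. f i)"
        using i by (rule continuous_map_product_projection)
      from openin_continuous_map_preimage[OF this, of T] \<open>open T\<close>
      have "openin (Rn_topology n) {f \<in> Rn_points n. f i \<in> T}"
        by (simp add: topspace_product_topology)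
      moreover have "(\<lambda>f. f i) -` T \<inter> space ?M = {f \<in> Rn_points n. f i \<in> T}"
        using sub by (auto simp: space_measure_of)
      ultimately show "(\<lambda>f. f i) -` T \<inter> space ?M \<in> sets ?M"
        using sub by auto
    qed
    from measurable_sets[OF this S]
    have "(\<lambda>f. f i) -` S \<inter> space ?M \<in> sets ?M" .
    moreover have "(\<lambda>f. f i) -` S \<inter> space ?M = {f \<in> Rn_points n. f i \<in> S}"
      using sub by (auto simp: space_measure_of)
    ultimately show "E \<in> sigma_sets (Rn_points n) {U. openin (Rn_topology n) U}"
      using sub by (simp add: E sets_measure_of)
  qed
  finally show "sets (Rn_borel n) \<subseteq> sigma_sets (Rn_points n) {U. openin (Rn_topology n) U}" .
  show "sigma_sets (Rn_points n) {U. openin (Rn_topology n) U} \<subseteq> sets (Rn_borel n)"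
    using sets.sigma_sets_subset[of "{U. openin (Rn_topology n) U}" "Rn_borel n"] openin_Rn_imp_sets
    by (auto simp: space_PiM)
qed

lemma emeasure_eta:
  fixes B :: "real set"
  assumes "B \<in> sets borel" "B \<subseteq> {0<..}"
  shows "emeasure eta B = (\<Sum>\<^sub>\<infinity>k::int. indicator B ((2::real) powi k))"
proof -
  have B: "B \<in> sets (restrict_space borel {0<..})"
    using assms by (auto simp: sets_restrict_space_iff)
  have "emeasure eta B = emeasure (count_space UNIV) {k::int. (2::real) powi k \<in> B}"
    unfolding eta_def using B by (subst emeasure_distr) (auto simp: space_restrict_space vimage_def)
  also have "\<dots> = (\<Sum>\<^sub>\<infinity>k\<in>{k::int. (2::real) powi k \<in> B}. 1)"
  proof (cases "finite {k::int. (2::real) powi k \<in> B}")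
    case False
    thus ?thesis
      using infsum_superconst_infinite_ennreal[of "{k::int. (2::real) powi k \<in> B}" 1 "\<lambda>_. 1"] by simp
  qed simp
  also have "\<dots> = (\<Sum>\<^sub>\<infinity>k::int. indicator B ((2::real) powi k))"
    using assms by (intro infsum_cong_neutral) (auto simp: indicator_def)
  finally show ?thesis .
qed

lemma dyadic_cube_inj:
  assumes "n \<ge> 1" "dyadic_cube n k m = dyadic_cube n k' m'"
  shows "k = k'"
proof -
  have interval: "(\<lambda>x. x 0) ` dyadic_cube n k m =
      {2 powi (- k) * real_of_int (m 0) ..< 2 powi (- k) * (real_of_int (m 0) + 1)}" for k m
  proof (intro equalityI subsetI)
    fix y assume "y \<in> {2 powi (- k) * real_of_int (m 0) ..< 2 powi (- k) * (real_of_int (m 0) + 1)}"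
    moreover have "(0::real) < 2 powi (- k)" by simp
    ultimately have "(\<lambda>i\<in>{..<n}. if i = 0 then y else 2 powi (- k) * real_of_int (m i))
        \<in> dyadic_cube n k m"
      by (auto simp: dyadic_cube_def algebra_simps)
    thus "y \<in> (\<lambda>x. x 0) ` dyadic_cube n k m"
      using assms(1) by (force intro: rev_image_eqI)
  qed (use assms(1) in \<open>auto simp: dyadic_cube_def\<close>)
  have "measure lborel ((\<lambda>x. x 0) ` dyadic_cube n k m) = 2 powi (- k)" for k m
    unfolding interval by (simp add: algebra_simps)
  hence "(2::real) powi (- k) = 2 powi (- k')"
    using assms(2) by metis
  thus ?thesis
    by (smt (verit) power_int_strict_increasing)
qed

lemma side_length_dyadic_cube:
  assumes "n \<ge> 1"
  shows "side_length n (dyadic_cube n k m) = 2 powi (- k)"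
  unfolding side_length_def using dyadic_cube_inj[OF assms] by (intro the_equality) blast+

end

theory Submission
  imports Defs
begin

text \<open>Let \<open>\<nu>(Q)\<close> be the \<open>p'\<close>-th power of the norm of \<open>\<mu>\<close> restricted to the Carleson box of \<open>Q\<close>, so that
  \<open>\<phi>\<^sub>Q\<close> has pairing \<open>\<nu>(Q)\<close> with \<open>\<mu>\<close> and \<open>p\<close>-th power norm \<open>\<nu>(Q)\<close>; the summand is then
  \<open>e(F) = [f]\<^sub>F\<^sup>p \<nu>(F)\<close>. The stopping condition only compares pairings with \<open>\<phi>\<^sub>F\<close>, but since \<open>p' \<le> 2\<close> the
  weighted AM-GM inequality turns it into \<open>\<Sum> \<nu>(F') \<le> A powr (- p' / 2) \<nu>(F)\<close> over the children \<open>F'\<close> of \<open>F\<close>.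
  Splitting the pairing of \<open>f\<close> and \<open>\<mu>\<close> over the box of \<open>F\<close> into the part outside the boxes of the
  children and those boxes, Young's inequality gives
  \<open>e(F) \<le> C \<parallel>f 1\<^bsub>E(F)\<^esub>\<parallel>\<^sup>p + 2/3 \<Sum> e(F')\<close> with \<open>E(F)\<close> the first part. The sets \<open>E(F)\<close> are disjoint, so their
  contributions add up to at most \<open>C \<parallel>f\<parallel>\<^sup>p\<close> because \<open>p \<ge> 2\<close>, and the other sum is absorbed. Each
  generation alone contributes at most \<open>C \<parallel>f\<parallel>\<^sup>p\<close>, which makes the absorption legitimate.\<close>

section \<open>Powers of extended nonnegative numbers\<close>

lemma ennpowr_ennreal [simp]: "0 \<le> a \<Longrightarrow> ennpowr (ennreal a) b = ennreal (a powr b)"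
  by (simp add: ennpowr_def)

lemma ennpowr_0 [simp]: "ennpowr 0 b = 0"
  by (simp add: ennpowr_def)

lemma ennpowr_top [simp]: "ennpowr top b = top"
  by (simp add: ennpowr_def)

lemma ennpowr_mono:
  assumes "x \<le> y" "0 \<le> b"
  shows "ennpowr x b \<le> ennpowr y b"
proof (cases y)
  case y: (real s)
  then obtain t where t: "x = ennreal t" "0 \<le> t"
    using assms(1) by (cases x) (auto simp: top_unique)
  show ?thesis
    using y t assms by (simp add: powr_mono2)
qed simp

text \<open>Every exponent, even a nonpositive one, fixes \<open>0\<close> and \<open>top\<close>;
  on the remaining values this is the usual power law.\<close>

lemma ennpowr_ennpowr: "ennpowr (ennpowr x a) b = ennpowr x (a * b)"
  by (cases x) (simp_all add: powr_powr)

lemma ennpowr_one [simp]: "ennpowr x 1 = x"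
  by (cases x) simp_all

lemma ennpowr_eq_top_iff [simp]: "ennpowr x b = top \<longleftrightarrow> x = top"
  by (cases x) simp_all

lemma ennpowr_eq_0_iff [simp]: "ennpowr x b = 0 \<longleftrightarrow> x = 0"
  by (cases x) (simp_all add: powr_eq_0_iff)

lemma measurable_ennpowr [measurable (raw)]:
  assumes "g \<in> borel_measurable M"
  shows "(\<lambda>x. ennpowr (g x) b) \<in> borel_measurable M"
  unfolding ennpowr_def using assms by measurable

lemma ennpowr_mult:
  assumes "0 < b"
  shows "ennpowr (x * y) b = ennpowr x b * ennpowr y b"
proof (cases x; cases y)
  fix s t :: real
  assume "0 \<le> s" "x = ennreal s" "0 \<le> t" "y = ennreal t"
  thus ?thesis by (simp add: powr_mult flip: ennreal_mult)
next
  fix s :: real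
  assume "0 \<le> s" "x = ennreal s" "y = top"
  thus ?thesis using assms by (cases "s = 0") (auto simp: ennreal_mult_top)
next
  fix t :: real
  assume "x = top" "0 \<le> t" "y = ennreal t"
  thus ?thesis using assms by (cases "t = 0") (auto simp: ennreal_top_mult)
qed simp

lemma ennpowr_half_square: "ennpowr (x\<^sup>2) (1 / 2) = x"
  by (cases x) (simp_all add: ennreal_power powr_half_sqrt power2_eq_square[of top])

text \<open>The form in which the squared Cauchy-Schwarz inequality becomes a bound on the integral
  itself.\<close>

lemma le_ennpowr_half:
  assumes "x\<^sup>2 \<le> a * b"
  shows "x \<le> ennpowr a (1 / 2) * ennpowr b (1 / 2)"
  using ennpowr_mono[OF assms, of "1 / 2"] by (simp add: ennpowr_half_square ennpowr_mult)

section \<open>Sums as integrals\<close>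

text \<open>Superadditivity of the \<open>b\<close>-th power: each term \<open>t\<close> is at most
  the total \<open>X\<close>, so \<open>t powr b \<le> X powr (b - 1) * t\<close>, and these bounds
  sum to \<open>X powr b\<close>. An infinite total is trivial.\<close>

lemma nn_integral_count_space_ennpowr_le:
  assumes "1 \<le> b"
  shows "(\<integral>\<^sup>+i. ennpowr (a i) b \<partial>count_space I) \<le> ennpowr (\<integral>\<^sup>+i. a i \<partial>count_space I) b"
proof (cases "\<integral>\<^sup>+i. a i \<partial>count_space I")
  case X: (real X)
  have le: "a i \<le> ennreal X" if "i \<in> I" for i
    using nn_integral_ge_point[OF that, of a] X by simp
  have "(\<integral>\<^sup>+i. ennpowr (a i) b \<partial>count_space I) \<le> (\<integral>\<^sup>+i. ennreal (X powr (b - 1)) * a i \<partial>count_space I)"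
  proof (intro nn_integral_mono)
    fix i assume "i \<in> space (count_space I)"
    with le have "a i \<le> ennreal X" by simp
    then obtain t where t: "a i = ennreal t" "0 \<le> t" "t \<le> X"
      using X by (cases "a i") (auto simp: top_unique)
    have "t powr b = t powr (b - 1) * t"
      using t by (cases "t = 0") (auto simp: powr_diff)
    also have "\<dots> \<le> X powr (b - 1) * t"
      using t assms by (intro mult_right_mono powr_mono2) auto
    finally show "ennpowr (a i) b \<le> ennreal (X powr (b - 1)) * a i"
      using t X by (simp flip: ennreal_mult)
  qed
  also have "\<dots> = ennreal (X powr (b - 1)) * ennreal X"
    using X by (simp add: nn_integral_cmult)
  also have "\<dots> = ennreal (X powr b)"
    using X by (cases "X = 0") (auto simp: powr_diff simp flip: ennreal_mult)
  finally show ?thesis using X by simp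
qed simp

text \<open>Both sides are suprema of finite partial sums, the right one after an enumeration of
  \<open>A\<close>. It lets the sum over scales in \<open>l2_norm\<close> be read as an integral
  against \<open>eta\<close>.\<close>

lemma infsum_eq_nn_integral_count_space:
  fixes f :: "'a \<Rightarrow> ennreal"
  assumes "countable A"
  shows "infsum f A = (\<integral>\<^sup>+x. f x \<partial>count_space A)"
proof (cases "finite A")
  case False
  have sup: "infsum f A = (SUP F\<in>{F. finite F \<and> F \<subseteq> A}. sum f F)"
    by (rule nonneg_infsum_complete) simp
  show ?thesis
  proof (rule antisym)
    show "infsum f A \<le> (\<integral>\<^sup>+x. f x \<partial>count_space A)"
      unfolding sup
    proof (intro SUP_least)
      fix F assume F: "F \<in> {F. finite F \<and> F \<subseteq> A}"
      hence "sum f F = (\<integral>\<^sup>+x. f x * indicator F x \<partial>count_space A)"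
        by (subst nn_integral_count_space'[of F]) auto
      also have "\<dots> \<le> (\<integral>\<^sup>+x. f x \<partial>count_space A)"
        by (intro nn_integral_mono) (auto simp: indicator_def)
      finally show "sum f F \<le> (\<integral>\<^sup>+x. f x \<partial>count_space A)" .
    qed
    have bij: "bij_betw (from_nat_into A) UNIV A"
      using assms False by (rule bij_betw_from_nat_into)
    have "(\<integral>\<^sup>+x. f x \<partial>count_space A) = (\<Sum>i. f (from_nat_into A i))"
      using nn_integral_bij_count_space[OF bij, of f] by (simp add: nn_integral_count_space_nat)
    also have "\<dots> = (SUP n. \<Sum>i<n. f (from_nat_into A i))"
      by (rule suminf_eq_SUP)
    also have "\<dots> \<le> infsum f A"
    proof (intro SUP_least)
      fix n :: nat
      have "(\<Sum>i<n. f (from_nat_into A i)) = sum f (from_nat_into A ` {..<n})"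
        using bij by (subst sum.reindex) (auto simp: bij_betw_def inj_on_def)
      also have "\<dots> \<le> infsum f A"
        unfolding sup using bij by (intro SUP_upper) (auto simp: bij_betw_def)
      finally show "(\<Sum>i<n. f (from_nat_into A i)) \<le> infsum f A" .
    qed
    finally show "(\<integral>\<^sup>+x. f x \<partial>count_space A) \<le> infsum f A" .
  qed
qed (simp add: nn_integral_count_space_finite)

section \<open>The measure \<open>eta\<close> and its atoms at the powers of two\<close>

lemma sigma_finite_measure_eta: "sigma_finite_measure eta"
proof
  let ?P = "range (\<lambda>k::int. (2::real) powi k)"
  have sets: "sets eta = sets (restrict_space borel {0<..})" and space: "space eta = {0<..}"
    by (simp_all add: eta_def space_restrict_space)
  have inj: "inj (\<lambda>k::int. (2::real) powi k)"
    by (smt (verit) injI power_int_strict_increasing)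
  have 1: "emeasure eta {2 powi k} = 1" for k :: int
  proof -
    have "{2 powi k :: real} \<in> sets (restrict_space borel {0<..})"
      by (auto simp: sets_restrict_space_iff)
    hence "emeasure eta {2 powi k} = emeasure (count_space UNIV) ((\<lambda>k::int. (2::real) powi k) -` {2 powi k})"
      unfolding eta_def by (subst emeasure_distr) (auto simp: space_restrict_space)
    also have "(\<lambda>k::int. (2::real) powi k) -` {2 powi k} = {k}"
      using inj by (auto simp: inj_def)
    finally show ?thesis by simp
  qed
  have P: "{0<..} - ?P \<in> sets (restrict_space borel {0<..})"
    by (auto simp: sets_restrict_space_iff intro!: sets.Diff sets.countable[of "?P" borel])
  have 0: "emeasure eta ({0<..} - ?P) = 0"
    unfolding eta_def using P by (subst emeasure_distr) (auto simp: space_restrict_space vimage_def)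
  \<comment> \<open>The atoms have mass 1 and the rest of the half-line is null, which gives a
    countable cover by sets of finite measure.\<close>
  show "\<exists>A. countable A \<and> A \<subseteq> sets eta \<and> \<Union>A = space eta \<and> (\<forall>a\<in>A. emeasure eta a \<noteq> \<infinity>)"
    using P by (intro exI[of _ "insert ({0<..} - ?P) (range (\<lambda>k::int. {(2::real) powi k}))"])
       (auto simp: 0 1 sets space sets_restrict_space_iff)
qed

lemma nn_integral_eta:
  assumes "g \<in> borel_measurable eta"
  shows "(\<integral>\<^sup>+t. g t \<partial>eta) = (\<Sum>\<^sub>\<infinity>k::int. g (2 powi (- k)))"
proof -
  have "(\<integral>\<^sup>+t. g t \<partial>eta) = (\<integral>\<^sup>+k. g (2 powi k) \<partial>count_space UNIV)"
    using assms unfolding eta_def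
    by (subst nn_integral_distr) (auto simp: space_restrict_space)
  \<comment> \<open>The reflection of the integers matches the convention of \<open>l2_norm\<close>,
    where index \<open>k\<close> refers to height \<open>2 powi (- k)\<close>.\<close>
  also have "\<dots> = (\<integral>\<^sup>+k. g (2 powi (- k)) \<partial>count_space UNIV)"
    using nn_integral_bij_count_space[of uminus "UNIV :: int set" UNIV "\<lambda>k. g (2 powi k)"]
    by (simp add: bij_uminus)
  also have "\<dots> = (\<Sum>\<^sub>\<infinity>k::int. g (2 powi (- k)))"
    by (simp add: infsum_eq_nn_integral_count_space)
  finally show ?thesis .
qed

section \<open>Dyadic cubes\<close>

text \<open>Cubes of one size are the fibres of a coordinatewise floor map, so that nesting becomes
  a matter of integer division.\<close>

lemma mem_dyadic_cube_iff_floor: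
  "x \<in> dyadic_cube n k m \<longleftrightarrow> x \<in> Rn_points n \<and> (\<forall>i<n. \<lfloor>2 powi k * x i\<rfloor> = m i)"
proof -
  have "2 powi (- k) * real_of_int (m i) \<le> x i \<and> x i < 2 powi (- k) * (real_of_int (m i) + 1) \<longleftrightarrow>
      \<lfloor>2 powi k * x i\<rfloor> = m i" for i
  proof -
    have "(2::real) powi k > 0" by simp
    thus ?thesis
      by (simp add: floor_eq_iff power_int_minus field_simps)
  qed
  thus ?thesis by (simp add: dyadic_cube_def)
qed

lemma dyadic_cube_nested_aux:
  assumes "k \<le> k'" "x \<in> dyadic_cube n k m" "x \<in> dyadic_cube n k' m'"
  shows "dyadic_cube n k' m' \<subseteq> dyadic_cube n k m"
proof
  fix y assume y: "y \<in> dyadic_cube n k' m'"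
  define d :: int where "d = 2 ^ nat (k' - k)"
  have d: "real_of_int d = 2 powi (k' - k)" "d \<ge> 0"
    using assms(1) by (auto simp: d_def power_int_def)
  \<comment> \<open>The coarse index is the integer quotient of the fine one, so points with equal
    fine indices have equal coarse indices.\<close>
  have coarse: "\<lfloor>2 powi k * z\<rfloor> = \<lfloor>2 powi k' * z\<rfloor> div d" for z :: real
  proof -
    have "2 powi k * z = 2 powi k' * z / real_of_int d"
      by (simp add: d power_int_diff)
    thus ?thesis using floor_divide_real_eq_div[OF d(2)] by metis
  qed
  show "y \<in> dyadic_cube n k m"
    using y assms(2,3) by (simp add: mem_dyadic_cube_iff_floor coarse)
qed

lemma dyadic_lattice_nested:
  assumes "Q \<in> dyadic_lattice n" "R \<in> dyadic_lattice n"
  shows "Q \<subseteq> R \<or> R \<subseteq> Q \<or> Q \<inter> R = {}"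
proof -
  obtain k m k' m' where QR: "Q = dyadic_cube n k m" "R = dyadic_cube n k' m'"
    using assms by (auto simp: dyadic_lattice_def)
  show ?thesis
    using dyadic_cube_nested_aux[of k k' _ n m m'] dyadic_cube_nested_aux[of k' k _ n m' m]
    unfolding QR by (cases "k \<le> k'") fastforce+
qed

lemma dyadic_lattice_nonempty:
  assumes "Q \<in> dyadic_lattice n"
  shows "Q \<noteq> {}"
proof -
  obtain k m where "Q = dyadic_cube n k m"
    using assms by (auto simp: dyadic_lattice_def)
  hence "(\<lambda>i\<in>{..<n}. 2 powi (- k) * real_of_int (m i)) \<in> Q"
    by (auto simp: mem_dyadic_cube_iff_floor power_int_minus simp flip: mult.assoc)
  thus ?thesis by blast
qed

lemma side_length_mono:
  assumes "n \<ge> 1" "Q \<in> dyadic_lattice n" "R \<in> dyadic_lattice n" "Q \<subseteq> R"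
  shows "side_length n Q \<le> side_length n R"
proof -
  obtain k m k' m' where QR: "Q = dyadic_cube n k m" "R = dyadic_cube n k' m'"
    using assms(2,3) by (auto simp: dyadic_lattice_def)
  obtain x where x: "x \<in> Q"
    using dyadic_lattice_nonempty[OF assms(2)] by blast
  have "k' \<le> k"
  proof (rule ccontr)
    assume "\<not> k' \<le> k"
    \<comment> \<open>If \<open>Q\<close> had the larger side, nesting at the common point
      \<open>x\<close> would give the reverse inclusion, hence equal cubes and equal scales.\<close>
    hence "R \<subseteq> Q"
      using dyadic_cube_nested_aux[of k k' x n m m'] x assms(4) by (auto simp: QR)
    with assms(4) have "dyadic_cube n k m = dyadic_cube n k' m'"
      by (auto simp: QR)
    from dyadic_cube_inj[OF assms(1) this] \<open>\<not> k' \<le> k\<close> show False by simp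
  qed
  thus ?thesis
    by (simp add: QR side_length_dyadic_cube[OF assms(1)] power_int_increasing)
qed

lemma carleson_box_mono:
  assumes "n \<ge> 1" "Q \<in> dyadic_lattice n" "R \<in> dyadic_lattice n" "Q \<subseteq> R"
  shows "carleson_box n Q \<subseteq> carleson_box n R"
  using side_length_mono[OF assms] assms(4) by (auto simp: carleson_box_def)

lemma countable_dyadic_lattice: "countable (dyadic_lattice n)"
proof -
  \<comment> \<open>A cube depends on \<open>m\<close> only through its values on
    \<open>{..<n}\<close>, which leaves countably many index vectors.\<close>
  have "dyadic_cube n k m \<in> (\<lambda>(k, m). dyadic_cube n k m) ` (UNIV \<times> ({..<n} \<rightarrow>\<^sub>E UNIV))" for k m
    by (rule image_eqI[of _ _ "(k, restrict m {..<n})"]) (auto simp: dyadic_cube_def)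
  hence "dyadic_lattice n \<subseteq> (\<lambda>(k, m). dyadic_cube n k m) ` (UNIV \<times> ({..<n} \<rightarrow>\<^sub>E UNIV))"
    by (auto simp: dyadic_lattice_def)
  moreover have "countable ((UNIV :: int set) \<times> ({..<n} \<rightarrow>\<^sub>E (UNIV :: int set)))"
    by (intro countable_SIGMA countable_PiE) auto
  ultimately show ?thesis
    by (meson countable_image countable_subset)
qed

lemma dyadic_lattice_sets:
  assumes "Q \<in> dyadic_lattice n"
  shows "Q \<in> sets (Rn_borel n)"
proof -
  obtain k m where Q: "Q = dyadic_cube n k m"
    using assms by (auto simp: dyadic_lattice_def)
  have "Q = {x \<in> space (Rn_borel n). \<forall>i\<in>{..<n}. 2 powi (- k) * real_of_int (m i) \<le> x i \<and>
                               x i < 2 powi (- k) * (real_of_int (m i) + 1)}"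
    by (auto simp: Q dyadic_cube_def space_PiM)
  also have "\<dots> \<in> sets (Rn_borel n)"
    by measurable
  finally show ?thesis .
qed

lemma carleson_box_sets:
  assumes "sets \<sigma> = sets (Rn_borel n)" "Q \<in> dyadic_lattice n"
  shows "carleson_box n Q \<in> sets (\<sigma> \<Otimes>\<^sub>M eta)"
proof -
  have "{0<..side_length n Q} \<in> sets eta"
    by (auto simp: eta_def sets_restrict_space_iff)
  thus ?thesis
    using dyadic_lattice_sets[OF assms(2)] assms(1) by (simp add: carleson_box_def)
qed

section \<open>Energies in a weighted product space\<close>

lemma nn_integral_count_space_indicator_le:
  assumes "disjoint_family_on A I" "\<And>i. i \<in> I \<Longrightarrow> A i \<subseteq> B"
  shows "(\<integral>\<^sup>+i. indicator (A i) x \<partial>count_space I) \<le> (indicator B x :: ennreal)"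
proof (cases "\<exists>i\<in>I. x \<in> A i")
  case True
  then obtain i where i: "i \<in> I" "x \<in> A i" by blast
  \<comment> \<open>Disjointness leaves one index with a nonzero term, so the integral is a single
    value whatever the size of the index set.\<close>
  have "x \<notin> A j" if "j \<in> I" "j \<noteq> i" for j
    using assms(1) i that by (auto simp: disjoint_family_on_def)
  hence "(\<integral>\<^sup>+j. indicator (A j) x \<partial>count_space I) = (\<Sum>j\<in>{i}. indicator (A j) x)"
    using i by (intro nn_integral_count_space') auto
  also have "\<dots> \<le> indicator B x"
    using i assms(2) by (auto simp: indicator_def)
  finally show ?thesis .
next
  case False
  hence "(\<integral>\<^sup>+i. indicator (A i) x \<partial>count_space I) = (\<integral>\<^sup>+i. 0 \<partial>count_space I)"
    by (intro nn_integral_cong) auto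
  thus ?thesis by simp
qed

lemma indicator_UN_le_nn_integral_count_space:
  "(indicator (\<Union>i\<in>I. A i) x :: ennreal) \<le> (\<integral>\<^sup>+i. indicator (A i) x \<partial>count_space I)"
proof (cases "\<exists>i\<in>I. x \<in> A i")
  case True
  then obtain i where i: "i \<in> I" "x \<in> A i" by blast
  thus ?thesis
    using nn_integral_ge_point[OF i(1), of "\<lambda>i. indicator (A i) x"] by (auto simp: indicator_def)
qed auto

text \<open>Weighted AM-GM, \<open>y powr r \<le> r * y + (1 - r)\<close>, at
  \<open>y = g / (s * \<theta>)\<close>. Later \<open>s\<close> and \<open>g\<close> are the squared
  slice norms of \<mu> over a box and a child box and \<open>r = q / 2\<close>, so that
  \<open>s powr (r - 1) * g\<close> is the slice of the pairing with the test function.\<close>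

lemma powr_le_weighted_sum:
  fixes s g \<theta> r :: real
  assumes "0 < \<theta>" "0 \<le> r" "r \<le> 1" "0 \<le> g" "0 < s"
  shows "g powr r \<le> \<theta> powr r * (r / \<theta> * (s powr (r - 1) * g) + (1 - r) * s powr r)"
proof (cases "g = 0")
  case False
  define y where "y = g / (s * \<theta>)"
  have y: "y > 0" "g = y * s * \<theta>"
    using assms False by (auto simp: y_def)
  have "y powr r * 1 powr (1 - r) \<le> r * y + (1 - r) * 1"
    using assms y by (intro Youngs_inequality_0) auto
  hence "\<theta> powr r * s powr r * y powr r \<le> \<theta> powr r * s powr r * (r * y + (1 - r))"
    by (intro mult_left_mono) auto
  also have "\<dots> = \<theta> powr r * (r / \<theta> * (s powr (r - 1) * g) + (1 - r) * s powr r)"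
    using assms y by (simp add: powr_diff field_simps)
  finally show ?thesis
    using assms y by (simp add: powr_mult mult_ac)
qed (use assms in auto)

lemma scaled_Young_inequality:
  fixes p q l :: real and a b :: ennreal
  assumes "1 < p" "1 < q" "1 / p + 1 / q = 1" "0 \<le> l"
  shows "ennreal (l powr (p - 1)) * (ennpowr a (1 / 2) * ennpowr b (1 / 2))
    \<le> ennreal (8 powr p) * ennpowr a (p / 2) + ennreal (l powr p / 8) * ennpowr b (q / 2)"
proof (cases "l = 0 \<or> a = top \<or> b = top")
  case True
  thus ?thesis
    using assms by (auto simp: ennreal_mult_top)
next
  case False
  then obtain s t where st: "a = ennreal s" "0 \<le> s" "b = ennreal t" "0 \<le> t" and l: "l > 0"
    using assms by (cases a; cases b) auto
  have pq: "(p - 1) * q = p"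
    using assms by (simp add: field_simps)
  \<comment> \<open>The factors 8 and 1/8 cancel in \<open>u * v\<close>. Since
    \<open>q > 1\<close>, the power of \<open>v\<close> then keeps a coefficient of at most 1/8,
    small enough to be absorbed later.\<close>
  define u where "u = 8 * s powr (1 / 2)"
  define v where "v = l powr (p - 1) * t powr (1 / 2) / 8"
  have "u * v \<le> u powr p / p + v powr q / q"
    using assms unfolding u_def v_def by (intro Youngs_inequality) auto
  also have "\<dots> \<le> u powr p + v powr q"
    using assms by (intro add_mono) (auto simp: divide_le_eq mult_le_cancel_left1)
  also have "u powr p = 8 powr p * s powr (p / 2)"
    unfolding u_def by (simp add: powr_mult powr_powr)
  also have "v powr q = l powr p * t powr (q / 2) / 8 powr q"
    unfolding v_def by (simp add: powr_mult powr_powr powr_divide pq)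
  also have "\<dots> \<le> l powr p * t powr (q / 2) / 8"
    using assms powr_mono[of 1 q "8::real"] by (intro divide_left_mono) auto
  finally have "l powr (p - 1) * (s powr (1 / 2) * t powr (1 / 2))
      \<le> 8 powr p * s powr (p / 2) + l powr p / 8 * t powr (q / 2)"
    by (simp add: u_def v_def mult_ac)
  thus ?thesis
    using st by (simp flip: ennreal_mult ennreal_plus)
qed

text \<open>The squared \<open>l2\<close> norm of a slice; unlike the norm, it is additive over
  disjoint sets \<open>B\<close>.\<close>

definition slice_sq :: "'b measure \<Rightarrow> ('a \<times> 'b \<Rightarrow> real) \<Rightarrow> ('a \<times> 'b) set \<Rightarrow> 'a \<Rightarrow> ennreal" where
  "slice_sq \<eta> g B x = (\<integral>\<^sup>+t. ennreal ((g (x, t))\<^sup>2) * indicator B (x, t) \<partial>\<eta>)"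

lemma slice_sq_mono: "B \<subseteq> C \<Longrightarrow> slice_sq \<eta> g B x \<le> slice_sq \<eta> g C x"
  unfolding slice_sq_def by (intro nn_integral_mono mult_left_mono) (auto simp: indicator_def)

text \<open>The analytic estimates use only measurability, inclusion and disjointness, so Carleson
  boxes are replaced by sets of a general product. Sigma-finiteness of \<eta> serves Tonelli with
  the \<eta>-integral inside; \<open>q\<close> is the exponent \<open>p'\<close>.\<close>

locale weighted_product = sigma_finite_measure \<eta>
  for \<eta> :: "'b measure" +
  fixes \<sigma> :: "'a measure" and \<mu> f :: "'a \<times> 'b \<Rightarrow> real" and p q :: real
  assumes mu_meas [measurable]: "\<mu> \<in> borel_measurable (\<sigma> \<Otimes>\<^sub>M \<eta>)"
    and f_meas [measurable]: "f \<in> borel_measurable (\<sigma> \<Otimes>\<^sub>M \<eta>)"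
    and mu_nonneg: "\<And>z. z \<in> space (\<sigma> \<Otimes>\<^sub>M \<eta>) \<Longrightarrow> 0 \<le> \<mu> z"
    and f_nonneg: "\<And>z. z \<in> space (\<sigma> \<Otimes>\<^sub>M \<eta>) \<Longrightarrow> 0 \<le> f z"
    and p_ge: "2 \<le> p" and pq: "1 / p + 1 / q = 1"
begin

section \<open>Slicewise estimates for pairings, weights and test functions\<close>

lemma q_eq: "q = p / (p - 1)"
  using pq p_ge by (cases "q = 0") (auto simp: field_simps)

lemma q_bounds: "1 < q" "q \<le> 2"
  using p_ge by (auto simp: q_eq field_simps)

lemma measurable_slice_sq [measurable]:
  assumes [measurable]: "g \<in> borel_measurable (\<sigma> \<Otimes>\<^sub>M \<eta>)" "B \<in> sets (\<sigma> \<Otimes>\<^sub>M \<eta>)"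
  shows "slice_sq \<eta> g B \<in> borel_measurable \<sigma>"
  unfolding slice_sq_def by measurable

definition pairing :: "('a \<times> 'b) set \<Rightarrow> ennreal" where
  "pairing B = (\<integral>\<^sup>+z. ennreal (f z * \<mu> z) * indicator B z \<partial>(\<sigma> \<Otimes>\<^sub>M \<eta>))"

definition weight :: "('a \<times> 'b) set \<Rightarrow> ennreal" where
  "weight B = (\<integral>\<^sup>+x. ennpowr (slice_sq \<eta> \<mu> B x) (q / 2) \<partial>\<sigma>)"

definition energy :: "('a \<times> 'b) set \<Rightarrow> ennreal" where
  "energy B = ennpowr (pairing B / weight B) p * weight B"

text \<open>The part of the test function that depends on \<open>x\<close> alone: the exponent
  \<open>q / 2 - 1\<close> on the squared norm is \<open>q - 2\<close> on the norm.\<close>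

definition test_factor :: "('a \<times> 'b) set \<Rightarrow> 'a \<Rightarrow> ennreal" where
  "test_factor B x = (let s = slice_sq \<eta> \<mu> B x in
     if s = 0 \<or> s = \<infinity> then 0 else ennreal (enn2real s powr (q / 2 - 1)))"

text \<open>For \<open>C \<subseteq> B\<close> this is the integral over \<open>C\<close> of the
  test function of \<open>B\<close> times \<mu>.\<close>

definition test_pairing :: "('a \<times> 'b) set \<Rightarrow> ('a \<times> 'b) set \<Rightarrow> ennreal" where
  "test_pairing B C = (\<integral>\<^sup>+x. test_factor B x * slice_sq \<eta> \<mu> C x \<partial>\<sigma>)"

lemma measurable_test_factor [measurable]:
  assumes [measurable]: "B \<in> sets (\<sigma> \<Otimes>\<^sub>M \<eta>)"
  shows "test_factor B \<in> borel_measurable \<sigma>"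
  unfolding test_factor_def Let_def by measurable

lemma pairing_mono: "B \<subseteq> C \<Longrightarrow> pairing B \<le> pairing C"
  unfolding pairing_def by (intro nn_integral_mono mult_left_mono) (auto simp: indicator_def)

lemma AE_slice_sq_finite:
  assumes "B \<in> sets (\<sigma> \<Otimes>\<^sub>M \<eta>)" "weight B < \<infinity>"
  shows "AE x in \<sigma>. slice_sq \<eta> \<mu> B x \<noteq> \<infinity>"
proof -
  have "AE x in \<sigma>. ennpowr (slice_sq \<eta> \<mu> B x) (q / 2) \<noteq> \<infinity>"
    using assms unfolding weight_def by (intro nn_integral_PInf_AE) auto
  thus ?thesis by simp
qed

text \<open>Cauchy-Schwarz on each slice. Enlarging \<open>E\<close> to \<open>B\<close> in the
  factor \<mu> only, the bound keeps \<open>f\<close> localised to \<open>E\<close> and produces the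
  weight of \<open>B\<close>.\<close>

lemma pairing_le_slices:
  assumes [measurable]: "E \<in> sets (\<sigma> \<Otimes>\<^sub>M \<eta>)" "B \<in> sets (\<sigma> \<Otimes>\<^sub>M \<eta>)" and "E \<subseteq> B"
  shows "pairing E \<le> (\<integral>\<^sup>+x. ennpowr (slice_sq \<eta> f E x) (1 / 2) * ennpowr (slice_sq \<eta> \<mu> B x) (1 / 2) \<partial>\<sigma>)"
proof -
  have "pairing E = (\<integral>\<^sup>+x. \<integral>\<^sup>+t. ennreal (f (x, t) * \<mu> (x, t)) * indicator E (x, t) \<partial>\<eta> \<partial>\<sigma>)"
    unfolding pairing_def by (subst nn_integral_fst[symmetric]) auto
  also have "\<dots> \<le> (\<integral>\<^sup>+x. ennpowr (slice_sq \<eta> f E x) (1 / 2) * ennpowr (slice_sq \<eta> \<mu> B x) (1 / 2) \<partial>\<sigma>)"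
  proof (intro nn_integral_mono le_ennpowr_half)
    fix x assume [measurable]: "x \<in> space \<sigma>"
    let ?F = "\<lambda>t. ennreal (f (x, t)) * indicator E (x, t)"
    let ?M = "\<lambda>t. ennreal (\<mu> (x, t)) * indicator B (x, t)"
    have nn: "0 \<le> f (x, t)" "0 \<le> \<mu> (x, t)" if "t \<in> space \<eta>" for t
      using that \<open>x \<in> space \<sigma>\<close> by (auto intro!: f_nonneg mu_nonneg simp: space_pair_measure)
    have "(\<integral>\<^sup>+t. ennreal (f (x, t) * \<mu> (x, t)) * indicator E (x, t) \<partial>\<eta>) = (\<integral>\<^sup>+t. ?F t * ?M t \<partial>\<eta>)"
      using nn \<open>E \<subseteq> B\<close> by (intro nn_integral_cong) (auto simp: ennreal_mult indicator_def)
    hence "(\<integral>\<^sup>+t. ennreal (f (x, t) * \<mu> (x, t)) * indicator E (x, t) \<partial>\<eta>)\<^sup>2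
        \<le> (\<integral>\<^sup>+t. (?F t)\<^sup>2 \<partial>\<eta>) * (\<integral>\<^sup>+t. (?M t)\<^sup>2 \<partial>\<eta>)"
      using Cauchy_Schwarz_nn_integral[of ?F \<eta> ?M] by simp
    also have "(\<integral>\<^sup>+t. (?F t)\<^sup>2 \<partial>\<eta>) = slice_sq \<eta> f E x"
      unfolding slice_sq_def using nn
      by (intro nn_integral_cong) (auto simp: ennreal_power indicator_def)
    also have "(\<integral>\<^sup>+t. (?M t)\<^sup>2 \<partial>\<eta>) = slice_sq \<eta> \<mu> B x"
      unfolding slice_sq_def using nn
      by (intro nn_integral_cong) (auto simp: ennreal_power indicator_def)
    finally show "(\<integral>\<^sup>+t. ennreal (f (x, t) * \<mu> (x, t)) * indicator E (x, t) \<partial>\<eta>)\<^sup>2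
        \<le> slice_sq \<eta> f E x * slice_sq \<eta> \<mu> B x" .
  qed
  finally show ?thesis .
qed

text \<open>A vanishing weight makes almost every slice of \<mu> vanish, and Cauchy-Schwarz then
  kills the pairing. This justifies the convention \<open>0 / 0 = 0\<close> for averages.\<close>

lemma pairing_eq_0:
  assumes [measurable]: "B \<in> sets (\<sigma> \<Otimes>\<^sub>M \<eta>)" and "weight B = 0"
  shows "pairing B = 0"
proof -
  have "AE x in \<sigma>. slice_sq \<eta> \<mu> B x = 0"
    using assms(2) unfolding weight_def by (subst (asm) nn_integral_0_iff_AE) auto
  hence "(\<integral>\<^sup>+x. ennpowr (slice_sq \<eta> f B x) (1 / 2) * ennpowr (slice_sq \<eta> \<mu> B x) (1 / 2) \<partial>\<sigma>) = 0"
    by (subst nn_integral_0_iff_AE) auto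
  thus ?thesis
    using pairing_le_slices[of B B] by simp
qed

text \<open>Young's inequality on each slice, then integration. When \<open>l\<close> is the average
  over \<open>B\<close>, the last term is an eighth of the energy of \<open>B\<close>.\<close>

lemma pairing_Young:
  assumes [measurable]: "E \<in> sets (\<sigma> \<Otimes>\<^sub>M \<eta>)" "B \<in> sets (\<sigma> \<Otimes>\<^sub>M \<eta>)" and "E \<subseteq> B" "0 \<le> l"
  shows "ennreal (l powr (p - 1)) * pairing E
    \<le> ennreal (8 powr p) * (\<integral>\<^sup>+x. ennpowr (slice_sq \<eta> f E x) (p / 2) \<partial>\<sigma>) + ennreal (l powr p / 8) * weight B"
proof -
  have "ennreal (l powr (p - 1)) * pairing E \<le> ennreal (l powr (p - 1)) *
      (\<integral>\<^sup>+x. ennpowr (slice_sq \<eta> f E x) (1 / 2) * ennpowr (slice_sq \<eta> \<mu> B x) (1 / 2) \<partial>\<sigma>)"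
    using pairing_le_slices[OF assms(1-3)] by (intro mult_left_mono) auto
  also have "\<dots> = (\<integral>\<^sup>+x. ennreal (l powr (p - 1)) *
      (ennpowr (slice_sq \<eta> f E x) (1 / 2) * ennpowr (slice_sq \<eta> \<mu> B x) (1 / 2)) \<partial>\<sigma>)"
    by (intro nn_integral_cmult[symmetric]) auto
  also have "\<dots> \<le> (\<integral>\<^sup>+x. ennreal (8 powr p) * ennpowr (slice_sq \<eta> f E x) (p / 2) +
      ennreal (l powr p / 8) * ennpowr (slice_sq \<eta> \<mu> B x) (q / 2) \<partial>\<sigma>)"
    using p_ge q_bounds pq \<open>0 \<le> l\<close> by (intro nn_integral_mono scaled_Young_inequality) auto
  also have "\<dots> = ennreal (8 powr p) * (\<integral>\<^sup>+x. ennpowr (slice_sq \<eta> f E x) (p / 2) \<partial>\<sigma>) +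
      ennreal (l powr p / 8) * weight B"
    unfolding weight_def by (simp add: nn_integral_add nn_integral_cmult)
  finally show ?thesis .
qed

lemma test_factor_mult_self:
  assumes "slice_sq \<eta> \<mu> B x \<noteq> \<infinity>"
  shows "test_factor B x * slice_sq \<eta> \<mu> B x = ennpowr (slice_sq \<eta> \<mu> B x) (q / 2)"
  using assms
  by (cases "slice_sq \<eta> \<mu> B x")
     (auto simp: test_factor_def powr_diff simp flip: ennreal_mult)

text \<open>On slices of finite norm \<open>s powr (q / 2 - 1) * s = s powr (q / 2)\<close>; finite
  weight makes the other slices a null set.\<close>

lemma test_pairing_self:
  assumes [measurable]: "B \<in> sets (\<sigma> \<Otimes>\<^sub>M \<eta>)" and "weight B < \<infinity>"
  shows "test_pairing B B = weight B"
  unfolding test_pairing_def weight_def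
  using AE_slice_sq_finite[OF assms] test_factor_mult_self
  by (intro nn_integral_cong_AE) (auto elim!: eventually_mono)

text \<open>Passes from the pairing with the test function of \<open>B\<close>, which the stopping
  rule controls, to the weight of \<open>C\<close> itself, by integrating
  \<open>powr_le_weighted_sum\<close>. The remainder carries \<open>indicator Q\<close>, so that
  over disjoint bases the remainders add up to at most \<open>weight B\<close>.\<close>

lemma weight_le_test_pairing:
  assumes [measurable]: "B \<in> sets (\<sigma> \<Otimes>\<^sub>M \<eta>)" "C \<in> sets (\<sigma> \<Otimes>\<^sub>M \<eta>)" "Q \<in> sets \<sigma>"
    and "weight B < \<infinity>" "C \<subseteq> B" "C \<subseteq> Q \<times> UNIV" "0 < \<theta>"
  shows "weight C \<le> ennreal (\<theta> powr (q / 2)) * (ennreal (q / 2 / \<theta>) * test_pairing B C +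
    ennreal (1 - q / 2) * (\<integral>\<^sup>+x. ennpowr (slice_sq \<eta> \<mu> B x) (q / 2) * indicator Q x \<partial>\<sigma>))"
proof -
  have "weight C \<le> (\<integral>\<^sup>+x. ennreal (\<theta> powr (q / 2)) *
    (ennreal (q / 2 / \<theta>) * (test_factor B x * slice_sq \<eta> \<mu> C x) +
     ennreal (1 - q / 2) * (ennpowr (slice_sq \<eta> \<mu> B x) (q / 2) * indicator Q x)) \<partial>\<sigma>)"
    unfolding weight_def
  proof (rule nn_integral_mono_AE, use AE_slice_sq_finite[OF assms(1,4)] in eventually_elim)
    fix x assume fin: "slice_sq \<eta> \<mu> B x \<noteq> \<infinity>"
    have le: "slice_sq \<eta> \<mu> C x \<le> slice_sq \<eta> \<mu> B x"
      using \<open>C \<subseteq> B\<close> by (rule slice_sq_mono)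
    show "ennpowr (slice_sq \<eta> \<mu> C x) (q / 2) \<le> ennreal (\<theta> powr (q / 2)) *
      (ennreal (q / 2 / \<theta>) * (test_factor B x * slice_sq \<eta> \<mu> C x) +
       ennreal (1 - q / 2) * (ennpowr (slice_sq \<eta> \<mu> B x) (q / 2) * indicator Q x))"
    proof (cases "x \<in> Q \<and> slice_sq \<eta> \<mu> B x \<noteq> 0")
      case True
      then obtain s g where sg: "slice_sq \<eta> \<mu> B x = ennreal s" "0 < s" "slice_sq \<eta> \<mu> C x = ennreal g" "0 \<le> g"
        using fin le by (cases "slice_sq \<eta> \<mu> B x"; cases "slice_sq \<eta> \<mu> C x") (auto simp: top_unique)
      have "g powr (q / 2) \<le> \<theta> powr (q / 2) *
          (q / 2 / \<theta> * (s powr (q / 2 - 1) * g) + (1 - q / 2) * s powr (q / 2))"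
        using sg q_bounds \<open>0 < \<theta>\<close> by (intro powr_le_weighted_sum) auto
      thus ?thesis
        using sg True q_bounds \<open>0 < \<theta>\<close>
        by (simp add: test_factor_def flip: ennreal_mult ennreal_plus)
    next
      case False
      \<comment> \<open>Either the slice of \<open>C\<close> is empty, or it lies in a slice of
        \<open>B\<close> on which \<mu> has norm zero.\<close>
      have "slice_sq \<eta> \<mu> C x = 0"
      proof (cases "x \<in> Q")
        case True
        thus ?thesis using False le by simp
      next
        case False
        hence "slice_sq \<eta> \<mu> C x = (\<integral>\<^sup>+t. 0 \<partial>\<eta>)"
          unfolding slice_sq_def using \<open>C \<subseteq> Q \<times> UNIV\<close>
          by (intro nn_integral_cong) (auto simp: indicator_def)
        thus ?thesis by simp
      qed
      thus ?thesis by simp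
    qed
  qed
  also have "\<dots> = ennreal (\<theta> powr (q / 2)) * (ennreal (q / 2 / \<theta>) * test_pairing B C +
    ennreal (1 - q / 2) * (\<integral>\<^sup>+x. ennpowr (slice_sq \<eta> \<mu> B x) (q / 2) * indicator Q x \<partial>\<sigma>))"
    unfolding test_pairing_def by (simp add: nn_integral_add nn_integral_cmult)
  finally show ?thesis .
qed

section \<open>Packing of the stopping children and the energy recursion\<close>

lemma weight_mono: "B \<subseteq> C \<Longrightarrow> weight B \<le> weight C"
  unfolding weight_def using q_bounds
  by (intro nn_integral_mono ennpowr_mono slice_sq_mono) auto

lemma nn_integral_pairing_le:
  assumes "countable \<C>" "\<And>C. C \<in> \<C> \<Longrightarrow> E C \<in> sets (\<sigma> \<Otimes>\<^sub>M \<eta>)" "\<And>C. C \<in> \<C> \<Longrightarrow> E C \<subseteq> B"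
    "disjoint_family_on E \<C>"
  shows "(\<integral>\<^sup>+C. pairing (E C) \<partial>count_space \<C>) \<le> pairing B"
proof -
  have "(\<integral>\<^sup>+C. pairing (E C) \<partial>count_space \<C>)
      = (\<integral>\<^sup>+z. \<integral>\<^sup>+C. ennreal (f z * \<mu> z) * indicator (E C) z \<partial>count_space \<C> \<partial>(\<sigma> \<Otimes>\<^sub>M \<eta>))"
    unfolding pairing_def using assms(1,2)
    by (intro nn_integral_count_space_nn_integral[symmetric] borel_measurable_times_ennreal
        borel_measurable_indicator) auto
  also have "\<dots> \<le> pairing B"
    unfolding pairing_def
    using nn_integral_count_space_indicator_le[OF assms(4,3)]
    by (intro nn_integral_mono) (auto simp: nn_integral_cmult intro!: mult_left_mono)
  finally show ?thesis .
qed

lemma pairing_le_nn_integral: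
  assumes "countable \<C>" "\<And>C. C \<in> \<C> \<Longrightarrow> E C \<in> sets (\<sigma> \<Otimes>\<^sub>M \<eta>)" and [measurable]: "B \<in> sets (\<sigma> \<Otimes>\<^sub>M \<eta>)"
  shows "pairing B \<le> pairing (B - (\<Union>C\<in>\<C>. E C)) + (\<integral>\<^sup>+C. pairing (E C) \<partial>count_space \<C>)"
proof -
  let ?U = "\<Union>C\<in>\<C>. E C"
  have [measurable]: "?U \<in> sets (\<sigma> \<Otimes>\<^sub>M \<eta>)"
    using assms(1,2) by (intro sets.countable_UN') auto
  have "pairing B \<le> (\<integral>\<^sup>+z. ennreal (f z * \<mu> z) * indicator (B - ?U) z +
      ennreal (f z * \<mu> z) * indicator ?U z \<partial>(\<sigma> \<Otimes>\<^sub>M \<eta>))"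
    unfolding pairing_def by (intro nn_integral_mono) (auto split: split_indicator)
  also have "\<dots> = pairing (B - ?U) + pairing ?U"
    unfolding pairing_def by (rule nn_integral_add) measurable
  also have "pairing ?U \<le> (\<integral>\<^sup>+z. \<integral>\<^sup>+C. ennreal (f z * \<mu> z) * indicator (E C) z \<partial>count_space \<C> \<partial>(\<sigma> \<Otimes>\<^sub>M \<eta>))"
    unfolding pairing_def
    by (intro nn_integral_mono)
       (auto simp: nn_integral_cmult intro!: mult_left_mono indicator_UN_le_nn_integral_count_space)
  also have "\<dots> = (\<integral>\<^sup>+C. pairing (E C) \<partial>count_space \<C>)"
    unfolding pairing_def using assms(1,2)
    by (intro nn_integral_count_space_nn_integral borel_measurable_times_ennreal
        borel_measurable_indicator) auto
  finally show ?thesis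
    by (auto intro: add_left_mono)
qed

text \<open>With \<open>y\<close> the average over \<open>B\<close>, Young bounds
  \<open>y * l powr (p - 1)\<close> by \<open>y powr p / p + l powr p / q\<close>, where
  \<open>1 / p \<le> 1 / 2\<close>; multiplying by the weight finishes. In the application
  \<open>B\<close> is a child and \<open>l\<close> the average over its parent.\<close>

lemma energy_Young:
  assumes "B \<in> sets (\<sigma> \<Otimes>\<^sub>M \<eta>)" "weight B < \<infinity>" "pairing B < \<infinity>" "0 \<le> l"
  shows "ennreal (l powr (p - 1)) * pairing B \<le> ennreal (1 / 2) * energy B + ennreal (l powr p) * weight B"
proof (cases "weight B = 0")
  case True
  thus ?thesis using pairing_eq_0[OF assms(1)] by simp
next
  case False
  then obtain v where v: "weight B = ennreal v" "0 < v"
    using assms(2) by (cases "weight B") auto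
  obtain j where j: "pairing B = ennreal j" "0 \<le> j"
    using assms(3) by (cases "pairing B") auto
  define y where "y = j / v"
  have y: "j = y * v" "j / v = y" "0 \<le> y"
    using v j by (auto simp: y_def)
  have e: "energy B = ennreal (y powr p * v)"
    using v j y(2,3) by (simp add: energy_def divide_ennreal flip: ennreal_mult)
  have "(p - 1) * q = p"
    using p_ge by (simp add: q_eq)
  hence "y * l powr (p - 1) \<le> y powr p / p + l powr p / q"
    using Youngs_inequality[of p q y "l powr (p - 1)"] p_ge q_bounds pq y by (simp add: powr_powr)
  also have "\<dots> \<le> y powr p / 2 + l powr p"
    using p_ge q_bounds y
    by (intro add_mono divide_left_mono) (auto simp: divide_le_eq mult_le_cancel_left1)
  finally have "y * l powr (p - 1) * v \<le> (y powr p / 2 + l powr p) * v"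
    using v by (intro mult_right_mono) auto
  thus ?thesis
    using v j(1) y(1,3) by (simp add: e algebra_simps del: ennreal_half flip: ennreal_mult ennreal_plus)
qed

text \<open>The stopping inequality cleared of denominators. A vanishing test pairing makes the left
  side zero; an infinite one makes the quotient zero, against the strict inequality.\<close>

lemma stopping_test_pairing_le:
  assumes "weight B < \<infinity>" "pairing B < \<infinity>" "weight B \<noteq> 0" "pairing B \<noteq> 0" "0 < A"
    and C: "C \<subseteq> B" "ennreal A * (pairing B / weight B) < pairing C / test_pairing B C"
  shows "ennreal A * pairing B * test_pairing B C \<le> weight B * pairing C"
proof -
  obtain w i where w: "weight B = ennreal w" "0 < w" and i: "pairing B = ennreal i" "0 < i"
    using assms(1-4) by (cases "weight B"; cases "pairing B") auto
  obtain j where j: "pairing C = ennreal j" "0 \<le> j"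
    using pairing_mono[OF C(1)] i by (cases "pairing C") (auto simp: top_unique)
  show ?thesis
  proof (cases "test_pairing B C")
    case (real t)
    show ?thesis
    proof (cases "t = 0")
      case False
      hence "A * (i / w) < j / t"
        using C(2) w i j real \<open>0 < A\<close>
        by (auto simp: divide_ennreal ennreal_less_iff simp flip: ennreal_mult)
      hence "A * i * t \<le> w * j"
        using False real w by (simp add: field_simps)
      thus ?thesis
        using w i j real \<open>0 < A\<close> by (simp flip: ennreal_mult)
    qed (use real in auto)
  next
    case top
    thus ?thesis using C(2) by simp
  qed
qed

lemma nn_integral_weight_le:
  assumes B: "B \<in> sets (\<sigma> \<Otimes>\<^sub>M \<eta>)" "weight B < \<infinity>" "pairing B < \<infinity>" "weight B \<noteq> 0" "pairing B \<noteq> 0"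
    and \<C>: "countable \<C>"
      "\<And>C. C \<in> \<C> \<Longrightarrow> E C \<in> sets (\<sigma> \<Otimes>\<^sub>M \<eta>)" "\<And>C. C \<in> \<C> \<Longrightarrow> E C \<subseteq> B"
      "\<And>C. C \<in> \<C> \<Longrightarrow> Q C \<in> sets \<sigma>" "\<And>C. C \<in> \<C> \<Longrightarrow> E C \<subseteq> Q C \<times> UNIV"
      "disjoint_family_on Q \<C>"
    and A: "64 \<le> A"
    and stop: "\<And>C. C \<in> \<C> \<Longrightarrow> ennreal A * (pairing B / weight B) < pairing (E C) / test_pairing B (E C)"
  shows "(\<integral>\<^sup>+C. weight (E C) \<partial>count_space \<C>) \<le> ennreal (1 / 8) * weight B"
proof -
  note [measurable] = B(1)
  let ?T = "\<integral>\<^sup>+C. test_pairing B (E C) \<partial>count_space \<C>"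
  let ?R = "\<integral>\<^sup>+C. \<integral>\<^sup>+x. ennpowr (slice_sq \<eta> \<mu> B x) (q / 2) * indicator (Q C) x \<partial>\<sigma> \<partial>count_space \<C>"
  obtain w i where w: "weight B = ennreal w" "0 < w" and i: "pairing B = ennreal i" "0 < i"
    using B(2-5) by (cases "weight B"; cases "pairing B") auto
  have disj: "disjoint_family_on E \<C>"
    using \<C>(5,6) unfolding disjoint_family_on_def by blast
  \<comment> \<open>Summing the stopping inequalities: the pairings over disjoint children add up to
    at most \<open>pairing B\<close>, and the common positive factor \<open>i\<close>
    cancels.\<close>
  have "ennreal (A * i) * ?T = (\<integral>\<^sup>+C. ennreal A * pairing B * test_pairing B (E C) \<partial>count_space \<C>)"
    using i A by (simp add: nn_integral_cmult ennreal_mult)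
  also have "\<dots> \<le> (\<integral>\<^sup>+C. weight B * pairing (E C) \<partial>count_space \<C>)"
    using stopping_test_pairing_le[OF B(2-5) _ \<C>(3) stop] A by (intro nn_integral_mono) auto
  also have "\<dots> \<le> weight B * pairing B"
    using nn_integral_pairing_le[OF \<C>(1-3) disj] by (auto simp: nn_integral_cmult intro!: mult_left_mono)
  also have "\<dots> = ennreal (w * i)"
    using w i by (simp add: ennreal_mult)
  finally have T: "ennreal A * ?T \<le> ennreal w"
    using w i A by (cases ?T) (auto simp: ennreal_mult_top top_unique simp flip: ennreal_mult)
  have "?R = (\<integral>\<^sup>+x. \<integral>\<^sup>+C. ennpowr (slice_sq \<eta> \<mu> B x) (q / 2) * indicator (Q C) x \<partial>count_space \<C> \<partial>\<sigma>)"
    using \<C>(1,4)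
    by (intro nn_integral_count_space_nn_integral[symmetric] borel_measurable_times_ennreal
        borel_measurable_indicator) auto
  also have "\<dots> \<le> weight B"
    unfolding weight_def
  proof (rule nn_integral_mono)
    fix x
    have "(\<integral>\<^sup>+C. indicator (Q C) x \<partial>count_space \<C>) \<le> (indicator UNIV x :: ennreal)"
      using \<C>(6) by (intro nn_integral_count_space_indicator_le) auto
    thus "(\<integral>\<^sup>+C. ennpowr (slice_sq \<eta> \<mu> B x) (q / 2) * indicator (Q C) x \<partial>count_space \<C>)
        \<le> ennpowr (slice_sq \<eta> \<mu> B x) (q / 2)"
      by (auto simp: nn_integral_cmult intro: mult_left_le)
  qed
  finally have R: "?R \<le> ennreal w" by (simp add: w)
  \<comment> \<open>Since \<open>q / 2 \<ge> 1 / 2\<close>, the power is at least the square root of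
    64; this is the source of the threshold on \<open>A\<close>.\<close>
  have A8: "8 \<le> A powr (q / 2)"
  proof -
    have "8 = 64 powr (1 / 2 :: real)"
      by (simp add: powr_half_sqrt real_sqrt_unique[of 8])
    also have "\<dots> \<le> A powr (1 / 2)"
      using A by (intro powr_mono2) auto
    also have "\<dots> \<le> A powr (q / 2)"
      using A q_bounds by (intro powr_mono) auto
    finally show ?thesis .
  qed
  \<comment> \<open>The choice \<open>\<theta> = 1 / A\<close> produces exactly the quantity
    \<open>A * ?T \<le> w\<close>. The coefficients \<open>q / 2\<close> and
    \<open>1 - q / 2\<close> then add up to 1, leaving the gain
    \<open>A powr (- q / 2)\<close>.\<close>
  have "(\<integral>\<^sup>+C. weight (E C) \<partial>count_space \<C>) \<le>
      (\<integral>\<^sup>+C. ennreal ((1 / A) powr (q / 2)) * (ennreal (q / 2 / (1 / A)) * test_pairing B (E C) +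
        ennreal (1 - q / 2) *
          (\<integral>\<^sup>+x. ennpowr (slice_sq \<eta> \<mu> B x) (q / 2) * indicator (Q C) x \<partial>\<sigma>)) \<partial>count_space \<C>)"
    using A \<C> B(1,2) by (intro nn_integral_mono weight_le_test_pairing) auto
  also have "\<dots> = ennreal ((1 / A) powr (q / 2)) * (ennreal (q / 2 * A) * ?T + ennreal (1 - q / 2) * ?R)"
    by (simp add: nn_integral_cmult nn_integral_add)
  also have "ennreal (q / 2 * A) * ?T = ennreal (q / 2) * (ennreal A * ?T)"
    using q_bounds A by (subst ennreal_mult) (auto simp: mult.assoc)
  also have "ennreal ((1 / A) powr (q / 2)) * (ennreal (q / 2) * (ennreal A * ?T) + ennreal (1 - q / 2) * ?R)
      \<le> ennreal ((1 / A) powr (q / 2)) * (ennreal (q / 2) * ennreal w + ennreal (1 - q / 2) * ennreal w)"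
    using T R by (intro mult_left_mono add_mono) auto
  also have "\<dots> = ennreal ((1 / A) powr (q / 2)) * ennreal w"
    using q_bounds w by (simp flip: distrib_right ennreal_plus)
  also have "\<dots> \<le> ennreal (1 / 8) * ennreal w"
    using A A8 by (intro mult_right_mono ennreal_leI) (auto simp: powr_divide field_simps)
  finally show ?thesis by (simp add: w)
qed

lemma energy_step:
  assumes B: "B \<in> sets (\<sigma> \<Otimes>\<^sub>M \<eta>)" "weight B < \<infinity>" "pairing B < \<infinity>"
    and \<C>: "countable \<C>"
      "\<And>C. C \<in> \<C> \<Longrightarrow> E C \<in> sets (\<sigma> \<Otimes>\<^sub>M \<eta>)" "\<And>C. C \<in> \<C> \<Longrightarrow> E C \<subseteq> B"
      "\<And>C. C \<in> \<C> \<Longrightarrow> Q C \<in> sets \<sigma>" "\<And>C. C \<in> \<C> \<Longrightarrow> E C \<subseteq> Q C \<times> UNIV"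
      "disjoint_family_on Q \<C>"
    and A: "64 \<le> A"
    and stop: "\<And>C. C \<in> \<C> \<Longrightarrow> ennreal A * (pairing B / weight B) < pairing (E C) / test_pairing B (E C)"
  shows "energy B \<le> ennreal (2 * 8 powr p) *
      (\<integral>\<^sup>+x. ennpowr (slice_sq \<eta> f (B - (\<Union>C\<in>\<C>. E C)) x) (p / 2) \<partial>\<sigma>) +
    ennreal (2 / 3) * (\<integral>\<^sup>+C. energy (E C) \<partial>count_space \<C>)"
proof (cases "weight B = 0 \<or> pairing B = 0")
  case True
  thus ?thesis by (auto simp: energy_def)
next
  case False
  then obtain w i where w: "weight B = ennreal w" "0 < w" and i: "pairing B = ennreal i" "0 < i"
    using B by (cases "weight B"; cases "pairing B") auto
  let ?D = "B - (\<Union>C\<in>\<C>. E C)"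
  let ?N = "\<integral>\<^sup>+x. ennpowr (slice_sq \<eta> f ?D x) (p / 2) \<partial>\<sigma>"
  let ?S = "\<integral>\<^sup>+C. energy (E C) \<partial>count_space \<C>"
  have D: "?D \<in> sets (\<sigma> \<Otimes>\<^sub>M \<eta>)"
    using B \<C>(1,2) by (intro sets.Diff sets.countable_UN') auto
  \<comment> \<open>With \<open>l\<close> the average over \<open>B\<close>, the energy is
    \<open>l powr (p - 1)\<close> times the pairing, and the pairing can be split between
    \<open>?D\<close> and the children.\<close>
  define l where "l = i / w"
  have l: "0 < l" "i = l * w" "i / w = l"
    using w i by (auto simp: l_def)
  define e where "e = l powr p * w"
  have energy: "energy B = ennreal e"
    using w i l(1,3) by (simp add: energy_def divide_ennreal e_def flip: ennreal_mult)
  have "energy B = ennreal (l powr (p - 1)) * pairing B"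
    using l(1,2) w i(1) by (simp add: energy e_def powr_diff flip: ennreal_mult)
  also have "\<dots> \<le> ennreal (l powr (p - 1)) * (pairing ?D + (\<integral>\<^sup>+C. pairing (E C) \<partial>count_space \<C>))"
    using pairing_le_nn_integral[OF \<C>(1,2) B(1)] by (intro mult_left_mono) auto
  also have "\<dots> = ennreal (l powr (p - 1)) * pairing ?D +
      (\<integral>\<^sup>+C. ennreal (l powr (p - 1)) * pairing (E C) \<partial>count_space \<C>)"
    by (simp add: distrib_left nn_integral_cmult)
  also have "\<dots> \<le> (ennreal (8 powr p) * ?N + ennreal (l powr p / 8) * weight B) +
      (\<integral>\<^sup>+C. ennreal (1 / 2) * energy (E C) + ennreal (l powr p) * weight (E C) \<partial>count_space \<C>)"
  proof (intro add_mono nn_integral_mono)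
    show "ennreal (l powr (p - 1)) * pairing ?D \<le> ennreal (8 powr p) * ?N + ennreal (l powr p / 8) * weight B"
      using D B(1) l by (intro pairing_Young) auto
    fix C assume "C \<in> space (count_space \<C>)"
    hence C: "C \<in> \<C>" by simp
    show "ennreal (l powr (p - 1)) * pairing (E C) \<le> ennreal (1 / 2) * energy (E C) + ennreal (l powr p) * weight (E C)"
      using weight_mono[OF \<C>(3)[OF C]] pairing_mono[OF \<C>(3)[OF C]] B l
      by (intro energy_Young \<C>(2) C) auto
  qed
  also have "\<dots> = (ennreal (8 powr p) * ?N + ennreal (e / 8)) +
      (ennreal (1 / 2) * ?S + ennreal (l powr p) * (\<integral>\<^sup>+C. weight (E C) \<partial>count_space \<C>))"
    using w by (simp add: nn_integral_add nn_integral_cmult e_def flip: ennreal_mult)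
  also have "\<dots> \<le> (ennreal (8 powr p) * ?N + ennreal (e / 8)) +
      (ennreal (1 / 2) * ?S + ennreal (l powr p) * (ennreal (1 / 8) * weight B))"
    using False by (intro add_left_mono mult_left_mono nn_integral_weight_le[OF B _ _ \<C> A stop]) auto
  also have "ennreal (l powr p) * (ennreal (1 / 8) * weight B) = ennreal (e / 8)"
    using w by (simp add: e_def flip: ennreal_mult)
  finally have main: "ennreal e \<le> (ennreal (8 powr p) * ?N + ennreal (e / 8)) + (ennreal (1 / 2) * ?S + ennreal (e / 8))"
    by (simp add: energy)
  have "0 \<le> e"
    using w by (simp add: e_def)
  show ?thesis
  proof (cases "?N = top \<or> ?S = top")
    case False
    then obtain N S where NS: "?N = ennreal N" "0 \<le> N" "?S = ennreal S" "0 \<le> S"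
      by (cases ?N; cases ?S) auto
    have "e \<le> (8 powr p * N + e / 8) + (1 / 2 * S + e / 8)"
      using main NS \<open>0 \<le> e\<close> by (simp del: ennreal_half flip: ennreal_mult ennreal_plus)
    moreover have "0 \<le> 8 powr p * N"
      using NS by simp
    \<comment> \<open>Moving both eighths of \<open>e\<close> to the left leaves
      \<open>3 / 4 * e\<close>. Division turns the coefficient 1/2 of \<open>S\<close> into 2/3,
      below 1 as absorption requires, and that of \<open>N\<close> into
      \<open>4 / 3 * 8 powr p\<close>, rounded up.\<close>
    ultimately have "e \<le> 2 * 8 powr p * N + 2 / 3 * S"
      by (simp add: algebra_simps)
    thus ?thesis
      using NS by (simp add: energy flip: ennreal_mult ennreal_plus)
  qed (auto simp: ennreal_mult_top)
qed

section \<open>Summation over disjoint sets and over generations\<close>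

lemma nn_integral_slices_le:
  assumes "countable I" "\<And>i. i \<in> I \<Longrightarrow> E i \<in> sets (\<sigma> \<Otimes>\<^sub>M \<eta>)" "\<And>i. i \<in> I \<Longrightarrow> E i \<subseteq> D"
    "disjoint_family_on E I"
  shows "(\<integral>\<^sup>+i. (\<integral>\<^sup>+x. ennpowr (slice_sq \<eta> f (E i) x) (p / 2) \<partial>\<sigma>) \<partial>count_space I)
    \<le> (\<integral>\<^sup>+x. ennpowr (slice_sq \<eta> f D x) (p / 2) \<partial>\<sigma>)"
proof -
  have "(\<integral>\<^sup>+i. (\<integral>\<^sup>+x. ennpowr (slice_sq \<eta> f (E i) x) (p / 2) \<partial>\<sigma>) \<partial>count_space I)
      = (\<integral>\<^sup>+x. (\<integral>\<^sup>+i. ennpowr (slice_sq \<eta> f (E i) x) (p / 2) \<partial>count_space I) \<partial>\<sigma>)"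
    using assms(1,2) f_meas
    by (intro nn_integral_count_space_nn_integral[symmetric] measurable_ennpowr measurable_slice_sq) auto
  also have "\<dots> \<le> (\<integral>\<^sup>+x. ennpowr (slice_sq \<eta> f D x) (p / 2) \<partial>\<sigma>)"
  proof (rule nn_integral_mono)
    fix x assume x [measurable]: "x \<in> space \<sigma>"
    \<comment> \<open>Disjoint pieces can still lie above the same \<open>x\<close>; superadditivity
      of the power \<open>p / 2 \<ge> 1\<close> merges their slices.\<close>
    have "(\<integral>\<^sup>+i. ennpowr (slice_sq \<eta> f (E i) x) (p / 2) \<partial>count_space I)
        \<le> ennpowr (\<integral>\<^sup>+i. slice_sq \<eta> f (E i) x \<partial>count_space I) (p / 2)"
      using p_ge by (intro nn_integral_count_space_ennpowr_le) auto
    also have "\<dots> \<le> ennpowr (slice_sq \<eta> f D x) (p / 2)"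
    proof (rule ennpowr_mono)
      have "(\<lambda>t. ennreal ((f (x, t))\<^sup>2) * indicator (E i) (x, t)) \<in> borel_measurable \<eta>" if "i \<in> I" for i
      proof -
        have [measurable]: "E i \<in> sets (\<sigma> \<Otimes>\<^sub>M \<eta>)" using assms(2) that .
        show ?thesis by measurable
      qed
      hence "(\<integral>\<^sup>+i. slice_sq \<eta> f (E i) x \<partial>count_space I)
          = (\<integral>\<^sup>+t. \<integral>\<^sup>+i. ennreal ((f (x, t))\<^sup>2) * indicator (E i) (x, t) \<partial>count_space I \<partial>\<eta>)"
        unfolding slice_sq_def by (intro nn_integral_count_space_nn_integral[symmetric] assms(1))
      also have "\<dots> \<le> slice_sq \<eta> f D x"
        unfolding slice_sq_def
        using nn_integral_count_space_indicator_le[OF assms(4,3)]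
        by (intro nn_integral_mono) (auto simp: nn_integral_cmult intro!: mult_left_mono)
      finally show "(\<integral>\<^sup>+i. slice_sq \<eta> f (E i) x \<partial>count_space I) \<le> slice_sq \<eta> f D x" .
    qed (use p_ge in auto)
    finally show "(\<integral>\<^sup>+i. ennpowr (slice_sq \<eta> f (E i) x) (p / 2) \<partial>count_space I)
        \<le> ennpowr (slice_sq \<eta> f D x) (p / 2)" .
  qed
  finally show ?thesis .
qed

text \<open>The recursion \<open>step\<close> is summed over finitely many generations and its last
  term absorbed, with \<open>top\<close> as a priori bound. A finite \<open>H\<close> suffices
  because the full sum is a supremum of finite ones.\<close>

lemma generations_energy_le:
  fixes gen :: "nat \<Rightarrow> 'c set" and ch :: "'c \<Rightarrow> 'c set" and E :: "'c \<Rightarrow> ('a \<times> 'b) set"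
  assumes gen_Suc: "\<And>k. gen (Suc k) = (\<Union>F\<in>gen k. ch F)"
    and gen: "\<And>k. countable (gen k)" "\<And>k. disjoint_family_on E (gen k)"
      "\<And>k F. F \<in> gen k \<Longrightarrow> E F \<in> sets (\<sigma> \<Otimes>\<^sub>M \<eta>)"
      "\<And>k F. F \<in> gen k \<Longrightarrow> E F \<noteq> {}"
    and ch: "\<And>k F G. F \<in> gen k \<Longrightarrow> G \<in> ch F \<Longrightarrow> E G \<subseteq> E F"
    and step: "\<And>k F. F \<in> gen k \<Longrightarrow> energy (E F) \<le>
      ennreal c * (\<integral>\<^sup>+x. ennpowr (slice_sq \<eta> f (E F - (\<Union>G\<in>ch F. E G)) x) (p / 2) \<partial>\<sigma>) +
      ennreal (2 / 3) * (\<integral>\<^sup>+G. energy (E G) \<partial>count_space (ch F))"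
    and top: "\<And>k F. F \<in> gen k \<Longrightarrow> energy (E F) \<le>
      ennreal c * (\<integral>\<^sup>+x. ennpowr (slice_sq \<eta> f (E F) x) (p / 2) \<partial>\<sigma>)"
    and "0 \<le> c" and H: "finite H" "H \<subseteq> (\<Union>k. gen k)"
  shows "(\<Sum>F\<in>H. energy (E F)) \<le> ennreal (5 * c) *
    (\<integral>\<^sup>+x. ennpowr (slice_sq \<eta> f (space (\<sigma> \<Otimes>\<^sub>M \<eta>)) x) (p / 2) \<partial>\<sigma>)"
proof -
  define J where "J D = (\<integral>\<^sup>+x. ennpowr (slice_sq \<eta> f D x) (p / 2) \<partial>\<sigma>)" for D
  let ?n = "J (space (\<sigma> \<Otimes>\<^sub>M \<eta>))"
  define U where "U k = (\<Union>F\<in>gen k. E F)" for k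
  define T where "T k = (\<integral>\<^sup>+F. energy (E F) \<partial>count_space (gen k))" for k
  have U_sets: "U k \<in> sets (\<sigma> \<Otimes>\<^sub>M \<eta>)" for k
    unfolding U_def using gen(1,3) by (intro sets.countable_UN') auto
  have "U (Suc k) \<subseteq> U k" for k
    using ch by (fastforce simp: U_def gen_Suc)
  hence U_mono: "U j \<subseteq> U i" if "i \<le> j" for i j
    using that by (rule lift_Suc_antimono_le)
  \<comment> \<open>The unions \<open>U k\<close> decrease, so for \<open>i < j\<close> the layer of
    \<open>j\<close> lies in \<open>U (Suc i)\<close>, which the layer of \<open>i\<close>
    avoids.\<close>
  have "disjoint_family_on (\<lambda>k. U k - U (Suc k)) {..<K}" for K
    unfolding disjoint_family_on_def
  proof (intro ballI impI)
    fix i j :: nat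
    assume "i \<noteq> j"
    hence "Suc i \<le> j \<or> Suc j \<le> i" by auto
    thus "(U i - U (Suc i)) \<inter> (U j - U (Suc j)) = {}"
      using U_mono[of "Suc i" j] U_mono[of "Suc j" i] by blast
  qed
  hence levels: "(\<Sum>k<K. J (U k - U (Suc k))) \<le> ?n" for K
    using nn_integral_slices_le[of "{..<K}" "\<lambda>k. U k - U (Suc k)" "space (\<sigma> \<Otimes>\<^sub>M \<eta>)"]
      U_sets sets.sets_into_space[OF U_sets]
    by (auto simp: J_def nn_integral_count_space_finite)
  \<comment> \<open>A child set can meet only its own parent within the parent generation. Hence
    \<open>E F\<close> without its own children misses the whole next generation, and, the sets
    being nonempty, no child has two parents.\<close>
  have ch_inter: "F = F'" if "F \<in> gen k" "F' \<in> gen k" "G \<in> ch F'" "E G \<inter> E F \<noteq> {}" for k F F' G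
  proof (rule ccontr)
    assume "F \<noteq> F'"
    hence "E F \<inter> E F' = {}"
      using gen(2)[of k] that by (auto simp: disjoint_family_on_def)
    thus False using ch[OF that(2,3)] that(4) by blast
  qed
  have within: "(\<integral>\<^sup>+F. J (E F - (\<Union>G\<in>ch F. E G)) \<partial>count_space (gen k)) \<le> J (U k - U (Suc k))" for k
    unfolding J_def
  proof (rule nn_integral_slices_le)
    fix F assume F: "F \<in> gen k"
    have "countable (ch F)"
      using gen(1)[of "Suc k"] F by (auto simp: gen_Suc intro: countable_subset)
    moreover have "E G \<in> sets (\<sigma> \<Otimes>\<^sub>M \<eta>)" if "G \<in> ch F" for G
      using gen(3)[of G "Suc k"] F that by (auto simp: gen_Suc)
    ultimately show "E F - (\<Union>G\<in>ch F. E G) \<in> sets (\<sigma> \<Otimes>\<^sub>M \<eta>)"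
      using gen(3)[OF F] by (intro sets.Diff sets.countable_UN') auto
    show "E F - (\<Union>G\<in>ch F. E G) \<subseteq> U k - U (Suc k)"
      using F ch_inter[OF F] by (fastforce simp: U_def gen_Suc)
  next
    show "disjoint_family_on (\<lambda>F. E F - (\<Union>G\<in>ch F. E G)) (gen k)"
      using gen(2)[of k] unfolding disjoint_family_on_def by blast
  qed (rule gen(1))
  have children: "(\<integral>\<^sup>+F. (\<integral>\<^sup>+G. energy (E G) \<partial>count_space (ch F)) \<partial>count_space (gen k)) \<le> T (Suc k)" for k
  proof -
    \<comment> \<open>Indicators extend the inner sum to the whole next generation, so that the two
      sums can be exchanged.\<close>
    have "(\<integral>\<^sup>+F. (\<integral>\<^sup>+G. energy (E G) \<partial>count_space (ch F)) \<partial>count_space (gen k)) =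
        (\<integral>\<^sup>+F. (\<integral>\<^sup>+G. energy (E G) * indicator (ch F) G \<partial>count_space (gen (Suc k))) \<partial>count_space (gen k))"
    proof (rule nn_integral_cong)
      fix F assume "F \<in> space (count_space (gen k))"
      hence "ch F \<subseteq> gen (Suc k)" by (auto simp: gen_Suc)
      hence "(\<integral>\<^sup>+G. energy (E G) * indicator (ch F) G \<partial>count_space (gen (Suc k))) =
          (\<integral>\<^sup>+G. energy (E G) * indicator (ch F) G \<partial>count_space (ch F))"
        by (intro nn_integral_count_space_eq) auto
      also have "\<dots> = (\<integral>\<^sup>+G. energy (E G) \<partial>count_space (ch F))"
        by (intro nn_integral_cong) auto
      finally show "(\<integral>\<^sup>+G. energy (E G) \<partial>count_space (ch F)) =
          (\<integral>\<^sup>+G. energy (E G) * indicator (ch F) G \<partial>count_space (gen (Suc k)))" ..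
    qed
    also have "\<dots> = (\<integral>\<^sup>+G. (\<integral>\<^sup>+F. energy (E G) * indicator (ch F) G \<partial>count_space (gen k)) \<partial>count_space (gen (Suc k)))"
      using gen(1) by (intro nn_integral_count_space_nn_integral) auto
    also have "\<dots> \<le> T (Suc k)"
      unfolding T_def
    proof (rule nn_integral_mono)
      fix G
      have "disjoint_family_on ch (gen k)"
        unfolding disjoint_family_on_def
      proof (intro ballI impI)
        fix F F' assume F: "F \<in> gen k" "F' \<in> gen k" "F \<noteq> F'"
        show "ch F \<inter> ch F' = {}"
        proof (rule ccontr)
          assume "ch F \<inter> ch F' \<noteq> {}"
          then obtain G where G: "G \<in> ch F" "G \<in> ch F'" by blast
          hence "E G \<inter> E F \<noteq> {}"
            using ch[OF F(1) G(1)] gen(4)[of G "Suc k"] F(1) by (auto simp: gen_Suc)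
          thus False using ch_inter[OF F(1,2) G(2)] F(3) by blast
        qed
      qed
      hence "(\<integral>\<^sup>+F. indicator (ch F) G \<partial>count_space (gen k)) \<le> (indicator UNIV G :: ennreal)"
        by (intro nn_integral_count_space_indicator_le) auto
      thus "(\<integral>\<^sup>+F. energy (E G) * indicator (ch F) G \<partial>count_space (gen k)) \<le> energy (E G)"
        by (auto simp: nn_integral_cmult intro: mult_left_le)
    qed
    finally show ?thesis .
  qed
  have T_step: "T k \<le> ennreal c * J (U k - U (Suc k)) + ennreal (2 / 3) * T (Suc k)" for k
  proof -
    have "T k \<le> (\<integral>\<^sup>+F. ennreal c * J (E F - (\<Union>G\<in>ch F. E G)) +
        ennreal (2 / 3) * (\<integral>\<^sup>+G. energy (E G) \<partial>count_space (ch F)) \<partial>count_space (gen k))"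
      unfolding T_def J_def using step by (intro nn_integral_mono) auto
    also have "\<dots> = ennreal c * (\<integral>\<^sup>+F. J (E F - (\<Union>G\<in>ch F. E G)) \<partial>count_space (gen k)) +
        ennreal (2 / 3) * (\<integral>\<^sup>+F. (\<integral>\<^sup>+G. energy (E G) \<partial>count_space (ch F)) \<partial>count_space (gen k))"
      by (simp add: nn_integral_add nn_integral_cmult)
    also have "\<dots> \<le> ennreal c * J (U k - U (Suc k)) + ennreal (2 / 3) * T (Suc k)"
      using within children by (intro add_mono mult_left_mono) auto
    finally show ?thesis .
  qed
  \<comment> \<open>This cruder bound makes each generation finite when the norm of \<open>f\<close>
    is, so that subtraction is legitimate, and it controls the boundary term \<open>T K\<close>
    below.\<close>
  have T_le: "T k \<le> ennreal c * ?n" for k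
  proof -
    have "T k \<le> (\<integral>\<^sup>+F. ennreal c * J (E F) \<partial>count_space (gen k))"
      unfolding T_def J_def using top by (intro nn_integral_mono) auto
    also have "\<dots> = ennreal c * (\<integral>\<^sup>+F. J (E F) \<partial>count_space (gen k))"
      by (simp add: nn_integral_cmult)
    also have "\<dots> \<le> ennreal c * ?n"
      unfolding J_def using gen sets.sets_into_space[OF gen(3)]
      by (intro mult_left_mono nn_integral_slices_le) auto
    finally show ?thesis .
  qed
  have sum_le: "(\<Sum>k<K. T k) \<le> ennreal (5 * c) * ?n" for K
  proof (cases "c = 0 \<or> ?n = top")
    case True
    show ?thesis
    proof (cases "c = 0")
      case True
      thus ?thesis using T_le by simp
    next
      case False
      with True \<open>0 \<le> c\<close> show ?thesis by (auto simp: ennreal_mult_top)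
    qed
  next
    case False
    then obtain N where N: "?n = ennreal N" "0 \<le> N" by (cases ?n) auto
    have "\<exists>t. T k = ennreal t \<and> 0 \<le> t" for k
      using T_le[of k] N \<open>0 \<le> c\<close> by (cases "T k") (auto simp: top_unique simp flip: ennreal_mult)
    then obtain t where t: "\<And>k. T k = ennreal (t k)" "\<And>k. 0 \<le> t k" by metis
    define S where "S = (\<Sum>k<K. t k)"
    have S: "(\<Sum>k<K. T k) = ennreal S"
      unfolding S_def t using t(2) by (rule sum_ennreal)
    have S0: "0 \<le> S"
      unfolding S_def using t(2) by (intro sum_nonneg)
    have "(\<Sum>k<K. T k) \<le> (\<Sum>k<K. ennreal c * J (U k - U (Suc k)) + ennreal (2 / 3) * T (Suc k))"
      by (intro sum_mono T_step)
    also have "\<dots> = ennreal c * (\<Sum>k<K. J (U k - U (Suc k))) + ennreal (2 / 3) * (\<Sum>k<K. T (Suc k))"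
      by (simp add: sum.distrib sum_distrib_left)
    \<comment> \<open>The shifted sum is at most the sum over \<open>k < Suc K\<close>, which
      exceeds the sum to be bounded only by \<open>T K\<close>.\<close>
    also have "\<dots> \<le> ennreal c * ennreal N + ennreal (2 / 3) * (\<Sum>k<Suc K. T k)"
      unfolding sum.lessThan_Suc_shift using levels[of K] N(1)
      by (intro add_mono mult_left_mono) auto
    also have "\<dots> = ennreal (c * N + 2 / 3 * (S + t K))"
      using S0 t(2) N(2) \<open>0 \<le> c\<close> by (simp add: S t(1)[of K] flip: ennreal_mult ennreal_plus)
    finally have "ennreal S \<le> ennreal (c * N + 2 / 3 * (S + t K))"
      unfolding S .
    hence "S \<le> c * N + 2 / 3 * (S + t K)"
      using N(2) \<open>0 \<le> c\<close> t(2)[of K] S0 by (subst (asm) ennreal_le_iff) auto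
    moreover have "t K \<le> c * N"
      using T_le[of K] N \<open>0 \<le> c\<close> by (simp add: t(1) flip: ennreal_mult)
    \<comment> \<open>From \<open>S / 3 \<le> m + 2 / 3 * u \<le> 5 / 3 * m\<close>: the origin of
      the factor 5.\<close>
    moreover have "S \<le> 5 * m" if "S \<le> m + 2 / 3 * (S + u)" "u \<le> m" for m u
      using that by (simp add: field_simps)
    ultimately have "S \<le> 5 * (c * N)" by blast
    thus ?thesis
      using N \<open>0 \<le> c\<close> by (simp add: S flip: ennreal_mult)
  qed
  \<comment> \<open>Each element is assigned one generation containing it, so it is counted once
    even if it occurs in several.\<close>
  have "\<forall>F\<in>H. \<exists>k. F \<in> gen k" using H(2) by auto
  then obtain \<kappa> where \<kappa>: "\<And>F. F \<in> H \<Longrightarrow> F \<in> gen (\<kappa> F)" by metis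
  define K where "K = Suc (Max (insert 0 (\<kappa> ` H)))"
  have K: "\<kappa> F \<in> {..<K}" if "F \<in> H" for F
    using that H(1) by (auto simp: K_def less_Suc_eq_le)
  have "(\<Sum>F\<in>H. energy (E F)) = (\<Sum>k<K. \<Sum>F\<in>{F \<in> H. \<kappa> F = k}. energy (E F))"
    using H(1) K by (intro sum.group[symmetric]) auto
  also have "\<dots> \<le> (\<Sum>k<K. T k)"
  proof (rule sum_mono)
    fix k
    have fin: "finite {F \<in> H. \<kappa> F = k}" using H(1) by simp
    have "(\<Sum>F\<in>{F \<in> H. \<kappa> F = k}. energy (E F)) =
        (\<integral>\<^sup>+F. energy (E F) * indicator {F \<in> H. \<kappa> F = k} F \<partial>count_space (gen k))"
      using \<kappa> by (subst nn_integral_count_space'[OF fin]) (auto intro!: sum.cong)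
    also have "\<dots> \<le> T k"
      unfolding T_def by (intro nn_integral_mono) (auto simp: indicator_def)
    finally show "(\<Sum>F\<in>{F \<in> H. \<kappa> F = k}. energy (E F)) \<le> T k" .
  qed
  also note sum_le
  finally show ?thesis by (simp add: J_def)
qed

end

section \<open>Stopping cubes\<close>

lemma space_eta: "space eta = {0<..}"
  by (simp add: eta_def space_restrict_space)

text \<open>Only squares at positive heights enter, so the same identity serves \<open>f\<close>,
  the truncations of \<mu> and the test functions.\<close>

lemma l2_norm_eq_slice_sq:
  assumes [measurable]: "g \<in> borel_measurable (\<sigma> \<Otimes>\<^sub>M eta)" "B \<in> sets (\<sigma> \<Otimes>\<^sub>M eta)" "x \<in> space \<sigma>"
    and h: "\<And>t. t > 0 \<Longrightarrow> (h (x, t))\<^sup>2 = (g (x, t))\<^sup>2 * indicator B (x, t)"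
  shows "l2_norm h x = ennpowr (slice_sq eta g B x) (1 / 2)"
proof -
  have "slice_sq eta g B x = (\<Sum>\<^sub>\<infinity>k::int. ennreal ((g (x, 2 powi (- k)))\<^sup>2) * indicator B (x, 2 powi (- k)))"
    unfolding slice_sq_def by (intro nn_integral_eta) measurable
  also have "\<dots> = (\<Sum>\<^sub>\<infinity>k::int. ennreal (\<bar>h (x, 2 powi (- k))\<bar>\<^sup>2))"
    by (intro infsum_cong) (auto simp: h indicator_def)
  finally show ?thesis by (simp add: l2_norm_def)
qed

lemma ennpowr_Lq_l2_norm:
  assumes "q > 0"
  shows "ennpowr (Lq_l2_norm q \<sigma> g) q = (\<integral>\<^sup>+x. ennpowr (l2_norm g x) q \<partial>\<sigma>)"
  using assms by (simp add: Lq_l2_norm_def ennpowr_ennpowr)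

lemma carleson_box_nonempty:
  assumes "n \<ge> 1" "Q \<in> dyadic_lattice n"
  shows "carleson_box n Q \<noteq> {}"
proof -
  obtain k m where "Q = dyadic_cube n k m"
    using assms(2) by (auto simp: dyadic_lattice_def)
  hence "side_length n Q > 0"
    by (simp add: side_length_dyadic_cube[OF assms(1)])
  thus ?thesis
    using dyadic_lattice_nonempty[OF assms(2)] by (auto simp: carleson_box_def)
qed

section \<open>Nesting and disjointness of the stopping generations\<close>

lemma stopping_children_subset:
  "stopping_children n p \<sigma> \<mu> f A F \<subseteq> {Q \<in> dyadic_lattice n. Q \<subseteq> F}"
  by (auto simp: stopping_children_def stopping_candidates_def)

text \<open>Maximality excludes inclusion between distinct children, and dyadic cubes without
  inclusion are disjoint.\<close>

lemma disjoint_stopping_children: "disjoint_family_on (\<lambda>Q. Q) (stopping_children n p \<sigma> \<mu> f A F)"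
  unfolding disjoint_family_on_def
proof (intro ballI impI)
  fix Q R
  assume QR: "Q \<in> stopping_children n p \<sigma> \<mu> f A F" "R \<in> stopping_children n p \<sigma> \<mu> f A F" "Q \<noteq> R"
  hence "\<not> Q \<subseteq> R" "\<not> R \<subseteq> Q"
    by (auto simp: stopping_children_def)
  thus "Q \<inter> R = {}"
    using QR stopping_children_subset[of n p \<sigma> \<mu> f A F] dyadic_lattice_nested[of Q n R] by blast
qed

lemma stopping_generation_subset:
  assumes "Q\<^sub>0 \<in> dyadic_lattice n"
  shows "stopping_generation n p \<sigma> \<mu> f A Q\<^sub>0 k \<subseteq> {Q \<in> dyadic_lattice n. Q \<subseteq> Q\<^sub>0}"
  using assms stopping_children_subset[of n p \<sigma> \<mu> f A]
  by (induction k) (simp_all, blast)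

lemma disjoint_stopping_generation:
  "disjoint_family_on (\<lambda>Q. Q) (stopping_generation n p \<sigma> \<mu> f A Q\<^sub>0 k)"
proof (induction k)
  case (Suc k)
  show ?case
    unfolding disjoint_family_on_def
  proof (intro ballI impI)
    fix Q R
    assume QR: "Q \<in> stopping_generation n p \<sigma> \<mu> f A Q\<^sub>0 (Suc k)"
      "R \<in> stopping_generation n p \<sigma> \<mu> f A Q\<^sub>0 (Suc k)" "Q \<noteq> R"
    then obtain F G where
      F: "F \<in> stopping_generation n p \<sigma> \<mu> f A Q\<^sub>0 k" "Q \<in> stopping_children n p \<sigma> \<mu> f A F" and
      G: "G \<in> stopping_generation n p \<sigma> \<mu> f A Q\<^sub>0 k" "R \<in> stopping_children n p \<sigma> \<mu> f A G"
      by auto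
    show "Q \<inter> R = {}"
    proof (cases "F = G")
      case True
      thus ?thesis
        using F(2) G(2) QR(3) disjoint_stopping_children[of n p \<sigma> \<mu> f A G]
        by (auto simp: disjoint_family_on_def)
    next
      case False
      hence "F \<inter> G = {}"
        using Suc F(1) G(1) by (auto simp: disjoint_family_on_def)
      thus ?thesis
        using F(2) G(2) stopping_children_subset[of n p \<sigma> \<mu> f A] by blast
    qed
  qed
qed (simp add: disjoint_family_on_def)

section \<open>Carleson boxes as an instance of the product-space estimates\<close>

locale carleson_weighted =
  weighted_product eta \<sigma> \<mu> f p "conj_exponent p"
  for \<sigma> :: "(nat \<Rightarrow> real) measure" and \<mu> f p +
  fixes n :: nat
  assumes n: "1 \<le> n" and sets_sigma: "sets \<sigma> = sets (Rn_borel n)"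
    and norm_finite: "\<And>Q. Q \<in> dyadic_lattice n \<Longrightarrow>
      Lq_l2_norm (conj_exponent p) \<sigma> (\<lambda>z. indicator (carleson_box n Q) z * \<mu> z) < \<infinity>"
begin

abbreviation box :: "(nat \<Rightarrow> real) set \<Rightarrow> ((nat \<Rightarrow> real) \<times> real) set" where
  "box \<equiv> carleson_box n"

lemma box_sets [measurable]: "Q \<in> dyadic_lattice n \<Longrightarrow> box Q \<in> sets (\<sigma> \<Otimes>\<^sub>M eta)"
  using sets_sigma by (rule carleson_box_sets)

lemma box_mono: "Q \<in> dyadic_lattice n \<Longrightarrow> R \<in> dyadic_lattice n \<Longrightarrow> Q \<subseteq> R \<Longrightarrow> box Q \<subseteq> box R"
  using n by (rule carleson_box_mono)

lemma l2_norm_box: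
  assumes "Q \<in> dyadic_lattice n" "x \<in> space \<sigma>"
  shows "l2_norm (\<lambda>z. indicator (box Q) z * \<mu> z) x = ennpowr (slice_sq eta \<mu> (box Q) x) (1 / 2)"
  using assms by (intro l2_norm_eq_slice_sq) (auto simp: indicator_def)

text \<open>The weight is the \<open>p'\<close>-th power of the norm that is finite by
  hypothesis.\<close>

lemma weight_box_finite:
  assumes "Q \<in> dyadic_lattice n"
  shows "weight (box Q) < \<infinity>"
proof -
  let ?q = "conj_exponent p"
  have "ennpowr (Lq_l2_norm ?q \<sigma> (\<lambda>z. indicator (box Q) z * \<mu> z)) ?q = weight (box Q)"
    unfolding weight_def using q_bounds assms
    by (subst ennpowr_Lq_l2_norm) (auto simp: l2_norm_box ennpowr_ennpowr intro!: nn_integral_cong)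
  thus ?thesis
    using norm_finite[OF assms] by (metis ennpowr_eq_top_iff infinity_ennreal_def less_top)
qed

lemma test_factor_finite: "test_factor B x < \<infinity>"
  by (simp add: test_factor_def Let_def)

lemma test_fun_eq:
  assumes "Q \<in> dyadic_lattice n" "x \<in> space \<sigma>"
  shows "test_fun n p \<mu> Q (x, t) =
    enn2real (test_factor (box Q) x) * (indicator (box Q) (x, t) * \<mu> (x, t))"
proof (cases "slice_sq eta \<mu> (box Q) x")
  case (real s)
  thus ?thesis
    using assms by (simp add: test_fun_def test_factor_def l2_norm_box powr_powr diff_divide_distrib)
next
  case top
  thus ?thesis
    using assms by (simp add: test_fun_def test_factor_def l2_norm_box)
qed

lemma box_integral_eq_pairing: "box_integral n \<sigma> \<mu> Q f = pairing (box Q)"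
  by (simp add: box_integral_def pairing_def)

lemma box_integral_test_fun:
  assumes "F \<in> dyadic_lattice n" "Q \<in> dyadic_lattice n" "Q \<subseteq> F"
  shows "box_integral n \<sigma> \<mu> Q (test_fun n p \<mu> F) = test_pairing (box F) (box Q)"
proof -
  note [measurable] = box_sets[OF assms(1)] box_sets[OF assms(2)]
  have "box_integral n \<sigma> \<mu> Q (test_fun n p \<mu> F) =
      (\<integral>\<^sup>+z. test_factor (box F) (fst z) * (ennreal ((\<mu> z)\<^sup>2) * indicator (box Q) z) \<partial>(\<sigma> \<Otimes>\<^sub>M eta))"
    unfolding box_integral_def
  proof (rule nn_integral_cong)
    fix z assume z: "z \<in> space (\<sigma> \<Otimes>\<^sub>M eta)"
    obtain x t where xt: "z = (x, t)" "x \<in> space \<sigma>"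
      using z by (auto simp: space_pair_measure)
    have "ennreal (enn2real (test_factor (box F) x)) = test_factor (box F) x"
      using test_factor_finite[of "box F" x] by simp
    \<comment> \<open>On \<open>box Q\<close> the indicator of \<open>box F\<close> is 1, by
      \<open>Q \<subseteq> F\<close> and monotonicity of boxes.\<close>
    thus "ennreal (test_fun n p \<mu> F z * \<mu> z) * indicator (box Q) z =
        test_factor (box F) (fst z) * (ennreal ((\<mu> z)\<^sup>2) * indicator (box Q) z)"
      using box_mono[OF assms(2,1,3)] xt
      by (auto simp: test_fun_eq[OF assms(1)] indicator_def power2_eq_square ennreal_mult' mult.assoc)
  qed
  also have "\<dots> = (\<integral>\<^sup>+x. \<integral>\<^sup>+t. test_factor (box F) x * (ennreal ((\<mu> (x, t))\<^sup>2) * indicator (box Q) (x, t)) \<partial>eta \<partial>\<sigma>)"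
    by (subst nn_integral_fst[symmetric]) auto
  also have "\<dots> = test_pairing (box F) (box Q)"
    unfolding test_pairing_def slice_sq_def
    by (intro nn_integral_cong nn_integral_cmult) measurable
  finally show ?thesis .
qed

text \<open>Since \<open>p * (p' - 1) = p'\<close>, the \<open>p\<close>-th power of the slice norm
  of the test function is \<open>s powr (p' / 2)\<close> for finite \<open>s\<close>, the squared
  slice norm of \<mu>. Where \<open>s\<close> is infinite the test function is zero, so the
  pointwise relation is an inequality, in the direction needed.\<close>

lemma norm_test_fun_le:
  assumes "Q \<in> dyadic_lattice n"
  shows "ennpowr (Lq_l2_norm p \<sigma> (test_fun n p \<mu> Q)) p \<le> weight (box Q)"
proof -
  note [measurable] = box_sets[OF assms]
  let ?q = "conj_exponent p"
  have pq': "p * (?q - 1) = ?q"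
    using p_ge by (simp add: q_eq field_simps)
  have "ennpowr (Lq_l2_norm p \<sigma> (test_fun n p \<mu> Q)) p = (\<integral>\<^sup>+x. ennpowr (l2_norm (test_fun n p \<mu> Q) x) p \<partial>\<sigma>)"
    using p_ge by (intro ennpowr_Lq_l2_norm) auto
  also have "\<dots> \<le> weight (box Q)"
    unfolding weight_def
  proof (rule nn_integral_mono)
    fix x assume x [measurable]: "x \<in> space \<sigma>"
    let ?c = "test_factor (box Q) x"
    have c: "ennreal (enn2real ?c) = ?c"
      using test_factor_finite[of "box Q" x] by simp
    have "l2_norm (test_fun n p \<mu> Q) x = ennpowr (slice_sq eta (\<lambda>z. enn2real ?c * \<mu> z) (box Q) x) (1 / 2)"
      using x by (intro l2_norm_eq_slice_sq) (auto simp: test_fun_eq[OF assms] indicator_def)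
    also have "slice_sq eta (\<lambda>z. enn2real ?c * \<mu> z) (box Q) x = ?c\<^sup>2 * slice_sq eta \<mu> (box Q) x"
    proof -
      have "slice_sq eta (\<lambda>z. enn2real ?c * \<mu> z) (box Q) x =
          (\<integral>\<^sup>+t. ?c\<^sup>2 * (ennreal ((\<mu> (x, t))\<^sup>2) * indicator (box Q) (x, t)) \<partial>eta)"
        unfolding slice_sq_def
        by (intro nn_integral_cong)
           (simp add: power_mult_distrib ennreal_mult c mult.assoc flip: ennreal_power)
      also have "\<dots> = ?c\<^sup>2 * slice_sq eta \<mu> (box Q) x"
        unfolding slice_sq_def by (intro nn_integral_cmult) measurable
      finally show ?thesis .
    qed
    finally have "ennpowr (l2_norm (test_fun n p \<mu> Q) x) p =
        ennpowr (?c\<^sup>2 * slice_sq eta \<mu> (box Q) x) (p / 2)"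
      by (simp add: ennpowr_ennpowr)
    also have "\<dots> \<le> ennpowr (slice_sq eta \<mu> (box Q) x) (?q / 2)"
    proof (cases "slice_sq eta \<mu> (box Q) x")
      case (real s)
      show ?thesis
      proof (cases "s = 0")
        case False
        have "(s powr (?q / 2 - 1))\<^sup>2 * s = s powr (?q - 1)"
        proof -
          have "(s powr (?q / 2 - 1))\<^sup>2 * s = s powr (?q / 2 - 1 + (?q / 2 - 1) + 1)"
            using real False by (simp only: powr_add power2_eq_square) simp
          thus ?thesis by simp
        qed
        moreover have "(s powr (?q - 1)) powr (p / 2) = s powr (?q / 2)"
          using pq' by (simp add: powr_powr mult.commute)
        ultimately show ?thesis
          using real False by (simp add: test_factor_def ennreal_power flip: ennreal_mult)
      qed (use real in auto)
    next
      case top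
      thus ?thesis by simp
    qed
    finally show "ennpowr (l2_norm (test_fun n p \<mu> Q) x) p \<le> ennpowr (slice_sq eta \<mu> (box Q) x) (?q / 2)" .
  qed
  finally show ?thesis .
qed

lemma norm_f_eq:
  "ennpowr (Lq_l2_norm p \<sigma> f) p = (\<integral>\<^sup>+x. ennpowr (slice_sq eta f (space (\<sigma> \<Otimes>\<^sub>M eta)) x) (p / 2) \<partial>\<sigma>)"
proof -
  have "l2_norm f x = ennpowr (slice_sq eta f (space (\<sigma> \<Otimes>\<^sub>M eta)) x) (1 / 2)" if "x \<in> space \<sigma>" for x
    using that by (intro l2_norm_eq_slice_sq[OF f_meas sets.top that]) (auto simp: space_pair_measure space_eta)
  thus ?thesis
    using p_ge by (subst ennpowr_Lq_l2_norm) (auto simp: ennpowr_ennpowr intro!: nn_integral_cong)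
qed

lemma summand_le_energy:
  assumes "Q \<in> dyadic_lattice n"
  shows "ennpowr (avg n p \<sigma> \<mu> f Q) p * ennpowr (Lq_l2_norm p \<sigma> (test_fun n p \<mu> Q)) p \<le> energy (box Q)"
proof -
  have "avg n p \<sigma> \<mu> f Q = pairing (box Q) / weight (box Q)"
    using assms weight_box_finite
    by (simp add: avg_def box_integral_eq_pairing box_integral_test_fun test_pairing_self)
  thus ?thesis
    using norm_test_fun_le[OF assms] by (simp add: energy_def mult_left_mono)
qed

lemma stopping_cubes_sum_le:
  assumes Q0: "Q\<^sub>0 \<in> dyadic_lattice n" "box_integral n \<sigma> \<mu> Q\<^sub>0 f < \<infinity>" and A: "64 \<le> A"
  shows "(\<Sum>\<^sub>\<infinity>F\<in>stopping_cubes n p \<sigma> \<mu> f A Q\<^sub>0.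
      ennpowr (avg n p \<sigma> \<mu> f F) p * ennpowr (Lq_l2_norm p \<sigma> (test_fun n p \<mu> F)) p)
    \<le> ennreal (10 * 8 powr p) * ennpowr (Lq_l2_norm p \<sigma> f) p"
proof -
  let ?gen = "stopping_generation n p \<sigma> \<mu> f A Q\<^sub>0"
  let ?ch = "stopping_children n p \<sigma> \<mu> f A"
  have gen: "F \<in> dyadic_lattice n" "F \<subseteq> Q\<^sub>0" if "F \<in> ?gen k" for F k
    using stopping_generation_subset[OF Q0(1)] that by blast+
  have ch: "Q \<in> dyadic_lattice n" "Q \<subseteq> F" if "Q \<in> ?ch F" for Q F
    using stopping_children_subset that by blast+
  have pairing_finite: "pairing (box F) < \<infinity>" if "F \<in> ?gen k" for F k
    using pairing_mono[OF box_mono[OF gen(1)[OF that] Q0(1) gen(2)[OF that]]] Q0(2)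
    by (auto simp: box_integral_eq_pairing)
  have base: "box Q \<subseteq> Q \<times> UNIV" "Q \<in> dyadic_lattice n \<Longrightarrow> Q \<in> sets \<sigma>" for Q
    using dyadic_lattice_sets[of Q n] sets_sigma by (auto simp: carleson_box_def)
  have disj: "disjoint_family_on box \<Q>" if "disjoint_family_on (\<lambda>Q. Q) \<Q>" for \<Q>
    unfolding disjoint_family_on_def
  proof (intro ballI impI)
    fix Q R assume "Q \<in> \<Q>" "R \<in> \<Q>" "Q \<noteq> R"
    hence "Q \<inter> R = {}"
      using that by (simp add: disjoint_family_on_def)
    thus "box Q \<inter> box R = {}"
      using base(1)[of Q] base(1)[of R] by blast
  qed
  have bound: "(\<Sum>F\<in>H. energy (box F)) \<le> ennreal (5 * (2 * 8 powr p)) * ennpowr (Lq_l2_norm p \<sigma> f) p"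
    if H: "finite H" "H \<subseteq> stopping_cubes n p \<sigma> \<mu> f A Q\<^sub>0" for H
    unfolding norm_f_eq
  proof (rule generations_energy_le[where gen = ?gen and ch = ?ch and E = box])
    show "?gen (Suc k) = (\<Union>F\<in>?gen k. ?ch F)" for k by simp
    show "countable (?gen k)" for k
      by (rule countable_subset[OF _ countable_dyadic_lattice[of n]]) (use gen(1) in blast)
    show "disjoint_family_on box (?gen k)" for k
      by (intro disj disjoint_stopping_generation)
    show "H \<subseteq> (\<Union>k. ?gen k)"
      using H(2) by (simp add: stopping_cubes_def)
  next
    fix k F assume F: "F \<in> ?gen k"
    show "box F \<in> sets (\<sigma> \<Otimes>\<^sub>M eta)" "box F \<noteq> {}"
      using gen(1)[OF F] n by (auto simp: box_sets carleson_box_nonempty)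
    show "box G \<subseteq> box F" if "G \<in> ?ch F" for G
      using ch[OF that] gen(1)[OF F] by (intro box_mono)
    show "energy (box F) \<le>
      ennreal (2 * 8 powr p) * (\<integral>\<^sup>+x. ennpowr (slice_sq eta f (box F - (\<Union>G\<in>?ch F. box G)) x) (p / 2) \<partial>\<sigma>) +
      ennreal (2 / 3) * (\<integral>\<^sup>+G. energy (box G) \<partial>count_space (?ch F))"
    proof (rule energy_step[where Q = "\<lambda>Q. Q", OF box_sets weight_box_finite pairing_finite])
      show "countable (?ch F)"
        by (rule countable_subset[OF _ countable_dyadic_lattice[of n]]) (use ch(1) in blast)
      fix C assume C: "C \<in> ?ch F"
      show "ennreal A * (pairing (box F) / weight (box F)) < pairing (box C) / test_pairing (box F) (box C)"
        using C gen(1)[OF F] ch[OF C] weight_box_finite[OF gen(1)[OF F]]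
        by (simp add: stopping_children_def stopping_candidates_def box_integral_eq_pairing
            box_integral_test_fun test_pairing_self)
      show "box C \<subseteq> box F"
        using ch[OF C] gen(1)[OF F] by (intro box_mono)
    qed (use A F gen(1)[OF F] ch base disjoint_stopping_children in auto)
    \<comment> \<open>The energy step for an empty family of children, where the stopping hypothesis
      is vacuous.\<close>
    show "energy (box F) \<le>
      ennreal (2 * 8 powr p) * (\<integral>\<^sup>+x. ennpowr (slice_sq eta f (box F) x) (p / 2) \<partial>\<sigma>)"
      using energy_step[where \<C> = "{}" and Q = "\<lambda>Q. Q" and A = A, OF box_sets weight_box_finite pairing_finite]
        A F gen(1)[OF F] by (simp add: nn_integral_count_space_finite disjoint_family_on_def)
  qed (use H in auto)
  show ?thesis
  proof (subst nonneg_infsum_complete, simp, intro SUP_least)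
    fix H assume H: "H \<in> {H. finite H \<and> H \<subseteq> stopping_cubes n p \<sigma> \<mu> f A Q\<^sub>0}"
    have "(\<Sum>F\<in>H. ennpowr (avg n p \<sigma> \<mu> f F) p * ennpowr (Lq_l2_norm p \<sigma> (test_fun n p \<mu> F)) p)
        \<le> (\<Sum>F\<in>H. energy (box F))"
      using H gen(1) by (intro sum_mono summand_le_energy) (auto simp: stopping_cubes_def)
    also have "\<dots> \<le> ennreal (10 * 8 powr p) * ennpowr (Lq_l2_norm p \<sigma> f) p"
      using bound[of H] H by simp
    finally show "(\<Sum>F\<in>H. ennpowr (avg n p \<sigma> \<mu> f F) p * ennpowr (Lq_l2_norm p \<sigma> (test_fun n p \<mu> F)) p)
        \<le> ennreal (10 * 8 powr p) * ennpowr (Lq_l2_norm p \<sigma> f) p" .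
  qed
qed

end

theorem proposition2p2:
  fixes p :: real
  assumes "p \<ge> 2"
  shows "\<exists>A\<^sub>p C\<^sub>p :: real. A\<^sub>p > 0 \<and> C\<^sub>p > 0 \<and>
    (\<forall>A \<ge> A\<^sub>p. \<forall>n \<ge> 1. \<forall>(\<sigma> :: (nat \<Rightarrow> real) measure) (\<mu> :: (nat \<Rightarrow> real) \<times> real \<Rightarrow> real)
        (f :: (nat \<Rightarrow> real) \<times> real \<Rightarrow> real) Q\<^sub>0.
      locally_finite_borel_measure n \<sigma> \<longrightarrow>
      \<mu> \<in> borel_measurable (\<sigma> \<Otimes>\<^sub>M eta) \<longrightarrow>
      (\<forall>z\<in>space (\<sigma> \<Otimes>\<^sub>M eta). \<mu> z \<ge> 0) \<longrightarrow>
      (\<forall>Q\<in>dyadic_lattice n.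
         Lq_l2_norm (conj_exponent p) \<sigma> (\<lambda>z. indicator (carleson_box n Q) z * \<mu> z) < \<infinity>) \<longrightarrow>
      Q\<^sub>0 \<in> dyadic_lattice n \<longrightarrow>
      f \<in> borel_measurable (\<sigma> \<Otimes>\<^sub>M eta) \<longrightarrow>
      (\<forall>z\<in>space (\<sigma> \<Otimes>\<^sub>M eta). f z \<ge> 0) \<longrightarrow>
      box_integral n \<sigma> \<mu> Q\<^sub>0 f < \<infinity> \<longrightarrow>
      (\<Sum>\<^sub>\<infinity>F\<in>stopping_cubes n p \<sigma> \<mu> f A Q\<^sub>0.
         ennpowr (avg n p \<sigma> \<mu> f F) p * ennpowr (Lq_l2_norm p \<sigma> (test_fun n p \<mu> F)) p)
      \<le> ennreal C\<^sub>p * ennpowr (Lq_l2_norm p \<sigma> f) p)"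
proof (rule exI[of _ 64], rule exI[of _ "10 * 8 powr p"], intro conjI allI impI)
  \<comment> \<open>The threshold 64 serves all \<open>p\<close>, because
    \<open>p' / 2 > 1 / 2\<close>. The constant is 5 from the absorption times
    \<open>2 * 8 powr p\<close> from the energy step.\<close>
  fix A :: real and n :: nat and \<sigma> :: "(nat \<Rightarrow> real) measure" and \<mu> f :: "(nat \<Rightarrow> real) \<times> real \<Rightarrow> real" and Q\<^sub>0
  assume A: "64 \<le> A" and n: "1 \<le> n" and \<sigma>: "locally_finite_borel_measure n \<sigma>"
    and \<mu>: "\<mu> \<in> borel_measurable (\<sigma> \<Otimes>\<^sub>M eta)" "\<forall>z\<in>space (\<sigma> \<Otimes>\<^sub>M eta). 0 \<le> \<mu> z"
      "\<forall>Q\<in>dyadic_lattice n.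
         Lq_l2_norm (conj_exponent p) \<sigma> (\<lambda>z. indicator (carleson_box n Q) z * \<mu> z) < \<infinity>"
    and Q\<^sub>0: "Q\<^sub>0 \<in> dyadic_lattice n"
    and f: "f \<in> borel_measurable (\<sigma> \<Otimes>\<^sub>M eta)" "\<forall>z\<in>space (\<sigma> \<Otimes>\<^sub>M eta). 0 \<le> f z"
      "box_integral n \<sigma> \<mu> Q\<^sub>0 f < \<infinity>"
  interpret sigma_finite_measure eta
    by (rule sigma_finite_measure_eta)
  interpret carleson_weighted \<sigma> \<mu> f p n
    using n \<sigma> \<mu> f(1,2) assms
    by unfold_locales
       (auto simp: locally_finite_borel_measure_def conj_exponent_def field_simps)
  show "(\<Sum>\<^sub>\<infinity>F\<in>stopping_cubes n p \<sigma> \<mu> f A Q\<^sub>0.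
      ennpowr (avg n p \<sigma> \<mu> f F) p * ennpowr (Lq_l2_norm p \<sigma> (test_fun n p \<mu> F)) p)
    \<le> ennreal (10 * 8 powr p) * ennpowr (Lq_l2_norm p \<sigma> f) p"
    using Q\<^sub>0 f(3) A by (rule stopping_cubes_sum_le)
qed simp_all

end
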